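(* Let $A\in\mathbb R^{m\times N}$ have unit columns, let $N\ge4$, let $\mathcal S=\{1,2,3\}$, and let $M:=A_{\bullet\mathcal S}^TA_{\bullet\mathcal S}$. Then every nonzero vector $x\in\mathbb R^N_+$ with $\mathrm{supp}(x)=\mathcal S$ is recovered from $y=Ax$ via constrained matching pursuit on $\mathcal P=\mathbb R^N_+$ if and only if each of the following conditions holds: (i) $A_{\bullet\mathcal S}$ has full column rank; (ii) $\big\|(A_{\bullet\mathcal S}^TA_{\bullet\mathcal S}u)_+\big\|_\infty>\big\|(A_{\bullet\mathcal S^c}^TA_{\bullet\mathcal S}u)_+\big\|_\infty$ for all $u\in\mathbb R^3_{++}$; (iii) for any $\mathcal J\in\{\{1\},\{2\},\{3\}\}$, $\big\|(M/M_{\mathcal J\mathcal J}\,v)_+\big\|_\infty>\big\|(A_{\bullet\mathcal S^c}^T[I-A_{\bullet\mathcal J}A_{\bullet\mathcal J}^T]A_{\bullet\mathcal S\setminus\mathcal J}\,v)_+\big\|_\infty$ for all $v\in\mathbb R^2_{++}$; (iv) all the following implications hold: $$\big[1-\vartheta_{12}^2>\min(\Delta_{13},\Delta_{23})\big]\Longrightarrow\big[\det M>\max_{i\in\mathcal S^c}\big(\vartheta_{i3}(1-\vartheta_{12}^2)-\vartheta_{i1}\Delta_{13}-\vartheta_{i2}\Delta_{23}\big)_+\big],$$ $$\big[1-\vartheta_{13}^2>\min(\Delta_{12},\Delta_{23})\big]\Longrightarrow\big[\det M>\max_{i\in\mathcal S^c}\big(\vartheta_{i2}(1-\vartheta_{13}^2)-\vartheta_{i1}\Delta_{12}-\vartheta_{i3}\Delta_{23}\big)_+\big],$$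 $$\big[1-\vartheta_{23}^2>\min(\Delta_{12},\Delta_{13})\big]\Longrightarrow\big[\det M>\max_{i\in\mathcal S^c}\big(\vartheta_{i1}(1-\vartheta_{23}^2)-\vartheta_{i2}\Delta_{12}-\vartheta_{i3}\Delta_{13}\big)_+\big],$$ where $\Delta_{12}:=\vartheta_{12}-\vartheta_{13}\vartheta_{23}$, $\Delta_{13}:=\vartheta_{13}-\vartheta_{12}\vartheta_{23}$, and $\Delta_{23}:=\vartheta_{23}-\vartheta_{12}\vartheta_{13}$.
   Context: Unit columns: $\|A_{\bullet i}\|_2=1$ for all $i$, where $A_{\bullet i}$ is the $i$th column; $A_{\bullet\mathcal I}$ is the submatrix of columns indexed by $\mathcal I$. $\vartheta_{ij}:=\langle A_{\bullet i},A_{\bullet j}\rangle$. $(\cdot)_+=\max(\cdot,0)$, applied componentwise to vectors. $\mathbb R^n_+$ and $\mathbb R^n_{++}$ are the nonnegative and positive orthants. $\mathrm{supp}(x)=\{i:x_i\ne0\}$; $\mathcal S^c=\{1,\dots,N\}\setminus\mathcal S$; $\mathbf e_j$ is the $j$th standard basis vector; $I$ is the $m\times m$ identity. For $\mathcal J\subset\mathcal S$ and $\mathcal I=\mathcal S\setminus\mathcal J$, with rows and columns of $M$ indexed by $\mathcal S$, the Schur complement is $M/M_{\mathcal J\mathcal J}:=M_{\mathcal I\mathcal I}-M_{\mathcal I\mathcal J}M_{\mathcal J\mathcal J}^{-1}M_{\mathcal J\mathcal I}$. Constrained matching pursuit on $\mathcal P$ with input $y$: $x^0=0$, $\mathcal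 J_0=\emptyset$; for $k=0,1,\dots$: let $g^*_j=\min\{\|y-A(x^k+t\mathbf e_j)\|_2^2:t\in\mathbb R,\ x^k+t\mathbf e_j\in\mathcal P\}$ for each $j$; choose any $j^*_{k+1}$ minimizing $g^*_j$ over $j\in\{1,\dots,N\}$; set $\mathcal J_{k+1}=\mathcal J_k\cup\{j^*_{k+1}\}$; choose any $x^{k+1}$ minimizing $\|Aw-y\|_2^2$ over $w\in\mathcal P$ with $\mathrm{supp}(w)\subseteq\mathcal J_{k+1}$. Several sequences may be generated due to non-unique choices. "$z$ is recovered" (exact vector recovery of $z$) means: with $y=Az$, along every generated sequence there is an $s$ with $\mathcal J_s=\mathrm{supp}(z)$, and along every sequence, once $\mathcal J_s=\mathrm{supp}(z)$ is reached, the minimization problem defining $x^s$ has the unique solution $x^s=z$. *)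

theory Defs
  imports "HOL-Analysis.Analysis"
begin

definition supp :: "real^'n \<Rightarrow> 'n set"
  where "supp x = {i. x $ i \<noteq> 0}"

definition nonneg_orthant :: "(real^'n) set"
  where "nonneg_orthant = {x. \<forall>i. 0 \<le> x $ i}"

definition pos_orthant :: "(real^'n) set"
  where "pos_orthant = {x. \<forall>i. 0 < x $ i}"

definition pos_part :: "real^'n \<Rightarrow> real^'n"
  where "pos_part x = (\<chi> i. max (x $ i) 0)"

text \<open>
  The sup-norm of the subvector of \<open>x\<close> with index set \<open>K\<close> (meant for nonempty \<open>K\<close>). Since the
  size of \<open>K\<close> is not a type, the sup-norm of a vector \<open>B\<^sub>K\<^sup>T w\<close>, where \<open>B\<^sub>K\<close> consists of the
  columns of \<open>B\<close> indexed by \<open>K\<close>, is rendered as \<open>infnorm_on K (transpose B *v w)\<close>.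
\<close>

definition infnorm_on :: "'n set \<Rightarrow> real^'n \<Rightarrow> real"
  where "infnorm_on K x = Max ((\<lambda>i. \<bar>x $ i\<bar>) ` K)"

lemma infnorm_on_UNIV: "infnorm_on UNIV x = infnorm x"
proof -
  have "{\<bar>x $ i\<bar> |i. i \<in> UNIV} = (\<lambda>i. \<bar>x $ i\<bar>) ` UNIV"
    by auto
  then show ?thesis
    by (simp add: infnorm_on_def infnorm_cart cSup_eq_Max)
qed

text \<open>
  Submatrices are selected by index vectors: \<open>f :: 'a^'k\<close> lists the \<open>CARD('k)\<close> chosen
  (pairwise distinct) indices.
\<close>

definition submat :: "real^'b^'a \<Rightarrow> 'a^'k \<Rightarrow> 'b^'l \<Rightarrow> real^'l^'k"
  where "submat M f g = (\<chi> i j. M $ (f $ i) $ (g $ j))"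

definition col_submat :: "real^'n^'m \<Rightarrow> 'n^'k \<Rightarrow> real^'k^'m"
  where "col_submat A f = (\<chi> i j. A $ i $ (f $ j))"

text \<open>
  The Schur complement of the block of \<open>M\<close> indexed by \<open>J\<close>; \<open>I\<close> has to list the indices that do
  not occur in \<open>J\<close>.
\<close>

definition schur_complement :: "real^'a^'a \<Rightarrow> 'a^'j \<Rightarrow> 'a^'i \<Rightarrow> real^'i^'i"
  where "schur_complement M J I =
    submat M I I - submat M I J ** matrix_inv (submat M J J) ** submat M J I"

text \<open>
  The value \<open>g\<^sup>*\<^sub>j\<close> of the one-dimensional problem at the iterate \<open>x\<close>. On the nonnegative
  orthant the infimum is always attained, so it is the minimum.
\<close>

definition cmp_objective :: "real^'n^'m \<Rightarrow> (real^'n) set \<Rightarrow> real^'m \<Rightarrow> real^'n \<Rightarrow> 'n \<Rightarrow> real"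
  where "cmp_objective A P y x j =
    Inf {(norm (y - A *v (x + t *\<^sub>R axis j 1)))\<^sup>2 | t. x + t *\<^sub>R axis j 1 \<in> P}"

definition cmp_solution ::
    "real^'n^'m \<Rightarrow> (real^'n) set \<Rightarrow> real^'m \<Rightarrow> 'n set \<Rightarrow> real^'n \<Rightarrow> bool"
  where "cmp_solution A P y J w \<longleftrightarrow>
    is_arg_min (\<lambda>w. (norm (A *v w - y))\<^sup>2) (\<lambda>w. w \<in> P \<and> supp w \<subseteq> J) w"

definition cmp_sequence ::
    "real^'n^'m \<Rightarrow> (real^'n) set \<Rightarrow> real^'m \<Rightarrow> (nat \<Rightarrow> real^'n) \<Rightarrow> (nat \<Rightarrow> 'n set) \<Rightarrow> bool"
  where "cmp_sequence A P y x J \<longleftrightarrow>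
    x 0 = 0 \<and> J 0 = {} \<and>
    (\<forall>k. \<exists>j. is_arg_min (cmp_objective A P y (x k)) (\<lambda>_. True) j \<and>
             J (Suc k) = insert j (J k) \<and>
             cmp_solution A P y (J (Suc k)) (x (Suc k)))"

definition cmp_recovered :: "real^'n^'m \<Rightarrow> (real^'n) set \<Rightarrow> real^'n \<Rightarrow> bool"
  where "cmp_recovered A P z \<longleftrightarrow>
    (\<forall>x J. cmp_sequence A P (A *v z) x J \<longrightarrow>
       (\<exists>s. J s = supp z) \<and>
       (\<forall>s. J s = supp z \<longrightarrow>
          x s = z \<and> (\<forall>w. cmp_solution A P (A *v z) (J s) w \<longleftrightarrow> w = z)))"

end

theory Submission
  imports Defs
begin

text \<open>
  By the optimality conditions of nonnegative least squares, the residual \<open>r\<close> of every iterate is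
  orthogonal to the columns in its support, so the selection rule picks a column that maximizes
  the positive part of its inner product with \<open>r\<close>. The first three selected indices exhaust the
  support \<open>S\<close> iff each of them lies in \<open>S\<close>, that is, iff at each stage every column outside \<open>S\<close> is
  beaten strictly by a column in \<open>S\<close>; full column rank then gives uniqueness. The residuals are
  \<open>y\<close>, then \<open>y\<close> minus its projection on one column, and finally either such a residual again (if
  a coefficient of the second iterate vanishes) or a positive multiple of the component of the
  third column orthogonal to the first two. The three stages give conditions (ii), (iii) and (iv).
  The premises in (iv) single out the pairs that can really be selected first: if
  \<open>1 - \<theta>\<^sub>p\<^sub>q\<^sup>2 \<le> \<Delta>\<^sub>q\<^sub>t\<close>, then after \<open>p\<close> the index \<open>t\<close> is strictly preferred to \<open>q\<close>, and otherwise a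
  vector with coefficients of decreasing magnitude in the order \<open>p\<close>, \<open>q\<close>, \<open>t\<close> forces the selection
  of \<open>p\<close> and \<open>q\<close> with an interior second iterate.
\<close>

section \<open>Nonnegative least squares\<close>

lemma inner_matrix_vector_mult:
  fixes A :: "real^'n^'m"
  shows "(A *v v) \<bullet> r = (\<Sum>j\<in>UNIV. v $ j * (column j A \<bullet> r))"
  by (simp add: matrix_mult_sum inner_sum_left scalar_mult_eq_scaleR)

lemma norm_diff_scaleR_square:
  fixes r c :: "'a::real_inner"
  assumes "norm c = 1"
  shows "(norm (r - t *\<^sub>R c))\<^sup>2 = (norm r)\<^sup>2 - 2 * t * (c \<bullet> r) + t\<^sup>2"
proof -
  have "c \<bullet> c = 1" using assms by (simp add: norm_eq_1)
  then show ?thesis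
    unfolding power2_norm_eq_inner
    by (simp add: inner_diff_left inner_diff_right inner_commute[of r c] power2_eq_square
        algebra_simps)
qed

text \<open>Exhibits the feasible set as a finitely generated cone, so that its image under
  \<open>A\<close> is closed whatever the rank of \<open>A\<close>.\<close>

lemma nonneg_supp_eq_convex_cone_hull:
  fixes J :: "'n::finite set"
  shows "{w \<in> nonneg_orthant. supp w \<subseteq> J} = convex_cone hull ((\<lambda>j. axis j (1::real)) ` J)" (is "?K = ?H")
proof
  show "?K \<subseteq> ?H"
  proof
    fix w :: "real^'n" assume w: "w \<in> ?K"
    have sums: "(\<Sum>i\<in>F. w $ i *\<^sub>R axis i (1::real)) \<in> ?H" if "finite F" for F
      using that
    proof induction
      case empty
      then show ?case by (simp add: convex_cone_hull_contains_0)
    next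
      case (insert i F)
      have "w $ i *\<^sub>R axis i (1::real) \<in> ?H"
      proof (cases "i \<in> J")
        case True
        then show ?thesis using w
          by (intro convex_cone_hull_mul hull_inc) (auto simp: nonneg_orthant_def)
      next
        case False
        then have "w $ i = 0" using w by (auto simp: supp_def)
        then show ?thesis by (simp add: convex_cone_hull_contains_0)
      qed
      then show ?case using insert by (simp add: convex_cone_hull_add)
    qed
    have "w = (\<Sum>i\<in>UNIV. w $ i *\<^sub>R axis i (1::real))"
      using basis_expansion[of w] by (simp add: scalar_mult_eq_scaleR)
    then show "w \<in> ?H" using sums[of UNIV] by simp
  qed
  have "convex_cone ?K"
    unfolding convex_cone_iff nonneg_orthant_def supp_def by auto force+
  moreover have "(\<lambda>j. axis j (1::real)) ` J \<subseteq> ?K"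
    by (auto simp: nonneg_orthant_def supp_def axis_def split: if_splits)
  ultimately show "?H \<subseteq> ?K" by (rule hull_minimal[rotated])
qed

text \<open>Closedness of the image cone gives a point nearest to \<open>y\<close>; the feasible set
  itself need not be bounded.\<close>

lemma cmp_solution_exists:
  fixes A :: "real^'n^'m"
  shows "\<exists>w. cmp_solution A nonneg_orthant y J w"
proof -
  let ?K = "{w \<in> nonneg_orthant. supp w \<subseteq> J}"
  have "(*v) A ` ?K = convex_cone hull ((*v) A ` (\<lambda>j. axis j 1) ` J)"
    by (simp add: nonneg_supp_eq_convex_cone_hull convex_cone_hull_linear_image)
  then have "closed ((*v) A ` ?K)" by (simp add: closed_convex_cone_hull)
  moreover have "0 \<in> ?K" by (simp add: nonneg_orthant_def supp_def)
  then have "(*v) A ` ?K \<noteq> {}" by blast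
  ultimately obtain c where c: "c \<in> (*v) A ` ?K" "\<And>d. d \<in> (*v) A ` ?K \<Longrightarrow> dist y c \<le> dist y d"
    by (rule distance_attains_inf[where a = y]) blast
  from c(1) obtain w where "w \<in> ?K" "c = A *v w" by (rule imageE)
  with c(2) have w: "w \<in> ?K" "\<And>v. v \<in> ?K \<Longrightarrow> dist y (A *v w) \<le> dist y (A *v v)" by auto
  then show ?thesis
    unfolding cmp_solution_def is_arg_min_linorder dist_norm
    by (intro exI[of _ w]) (auto simp: norm_minus_commute power_mono)
qed

text \<open>Supplies the large weights with which the necessity proofs force a prescribed order of
  selection.\<close>

lemma ex_scale_dominating:
  fixes c d :: "'a \<Rightarrow> real"
  assumes "finite F" "\<forall>k\<in>F. 0 < d k"
  shows "\<exists>K>0. \<forall>k\<in>F. c k \<le> K * d k"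
proof (intro exI conjI ballI)
  let ?K = "1 + (\<Sum>k\<in>F. \<bar>c k\<bar> / d k)"
  have "0 \<le> (\<Sum>k\<in>F. \<bar>c k\<bar> / d k)" using assms(2) by (intro sum_nonneg) (simp add: less_imp_le)
  then show "0 < ?K" by simp
  fix k assume k: "k \<in> F"
  have "\<bar>c k\<bar> / d k \<le> (\<Sum>k\<in>F. \<bar>c k\<bar> / d k)"
    using assms k by (intro member_le_sum) (auto simp: less_imp_le)
  then have "\<bar>c k\<bar> / d k \<le> ?K" by simp
  then have "\<bar>c k\<bar> \<le> ?K * d k" using assms(2) k by (simp add: pos_divide_le_eq)
  then show "c k \<le> ?K * d k" by simp
qed

locale unit_column_matrix =
  fixes A :: "real^'n^'m"
  assumes norm_column: "norm (column i A) = 1"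
begin

abbreviation col :: "'n \<Rightarrow> real^'m" where "col i \<equiv> column i A"

lemma inner_col_self: "col i \<bullet> col i = 1"
  using norm_column[of i] by (simp add: norm_eq_1)

text \<open>Optimality conditions of a convex problem: perturbing one coordinate at a time gives
  necessity, and the variational inequality of the residual against all feasible directions gives
  sufficiency.\<close>

lemma cmp_solution_iff_kkt:
  "cmp_solution A nonneg_orthant y J w \<longleftrightarrow>
    w \<in> nonneg_orthant \<and> supp w \<subseteq> J \<and>
    (\<forall>j\<in>J. col j \<bullet> (y - A *v w) \<le> 0 \<and> (w $ j = 0 \<or> col j \<bullet> (y - A *v w) = 0))"
  (is "_ \<longleftrightarrow> ?kkt")
proof
  define r where "r = y - A *v w"
  assume sol: "cmp_solution A nonneg_orthant y J w"
  then have w: "w \<in> nonneg_orthant" "supp w \<subseteq> J" and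
    opt: "\<And>v. v \<in> nonneg_orthant \<Longrightarrow> supp v \<subseteq> J \<Longrightarrow> norm (A *v w - y) \<le> norm (A *v v - y)"
    by (auto simp: cmp_solution_def is_arg_min_linorder power_mono_iff)
  have "col j \<bullet> r \<le> 0 \<and> (w $ j = 0 \<or> col j \<bullet> r = 0)" if j: "j \<in> J" for j
  proof -
    define c where "c = col j \<bullet> r"
    \<comment> \<open>The unconstrained optimum \<open>c\<close> of the one-coordinate quadratic,
      clipped at the step where coordinate \<open>j\<close> reaches 0.\<close>
    define t where "t = max c (- w $ j)"
    have wj: "0 \<le> w $ j" using w by (simp add: nonneg_orthant_def)
    have "w + t *\<^sub>R axis j 1 \<in> nonneg_orthant" "supp (w + t *\<^sub>R axis j 1) \<subseteq> J"
      using w j by (auto simp: nonneg_orthant_def supp_def t_def axis_def)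
    from opt[OF this] have "norm r \<le> norm (r - t *\<^sub>R col j)"
      by (simp add: matrix_vector_right_distrib matrix_vector_mult_scaleR
          matrix_vector_mult_basis r_def
          norm_minus_commute algebra_simps)
    then have "(norm r)\<^sup>2 \<le> (norm (r - t *\<^sub>R col j))\<^sup>2" by (simp add: power_mono)
    then have *: "0 \<le> t * (t - 2 * c)"
      unfolding norm_diff_scaleR_square[OF norm_column] c_def
      by (simp add: algebra_simps power2_eq_square)
    show ?thesis
    proof (cases "c \<ge> - w $ j")
      case True
      then have "t = c" by (simp add: t_def)
      with * have "0 \<le> - (c * c)" by (simp add: algebra_simps)
      then have "c = 0" by (auto simp: mult_le_0_iff)
      then show ?thesis by (simp add: c_def)
    next
      case False
      then have t: "t = - w $ j" "0 < t - 2 * c" using wj by (auto simp: t_def)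
      have "0 \<le> t" using * t(2) by (auto simp: zero_le_mult_iff)
      with wj t(1) have "w $ j = 0" by simp
      then show ?thesis using False by (simp add: c_def)
    qed
  qed
  then show ?kkt using w by (simp add: r_def)
next
  define r where "r = y - A *v w"
  assume ?kkt
  then have w: "w \<in> nonneg_orthant" "supp w \<subseteq> J" and
    kkt: "\<And>j. j \<in> J \<Longrightarrow> col j \<bullet> r \<le> 0 \<and> (w $ j = 0 \<or> col j \<bullet> r = 0)"
    by (auto simp: r_def)
  have "norm (A *v w - y) \<le> norm (A *v v - y)" if v: "v \<in> nonneg_orthant" "supp v \<subseteq> J" for v
  proof -
    have "(v - w) $ j * (col j \<bullet> r) \<le> 0" for j
    proof (cases "j \<in> J")
      case True
      have "0 \<le> v $ j" using v by (simp add: nonneg_orthant_def)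
      then show ?thesis using kkt[OF True] by (auto simp: mult_nonneg_nonpos)
    next
      case False
      then have "v $ j = 0" "w $ j = 0" using v w by (auto simp: supp_def)
      then show ?thesis by simp
    qed
    then have "(A *v (v - w)) \<bullet> r \<le> 0"
      unfolding inner_matrix_vector_mult by (simp add: sum_nonpos)
    \<comment> \<open>Expanding the square on the right adds the square of
      \<open>A *v (v - w)\<close> and minus twice its inner product with \<open>r\<close>, both
      nonnegative.\<close>
    then have "norm r \<le> norm (A *v (v - w) - r)"
      unfolding norm_le inner_diff_left inner_diff_right inner_commute[of r "A *v (v - w)"]
      using inner_ge_zero[of "A *v (v - w)"] by linarith
    then show ?thesis
      by (simp add: r_def matrix_vector_mult_diff_distrib norm_minus_commute)
  qed
  then show "cmp_solution A nonneg_orthant y J w"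
    using w by (auto simp: cmp_solution_def is_arg_min_linorder power_mono)
qed

section \<open>The selection rule\<close>

text \<open>If \<open>x $ j > 0\<close>, the correlation vanishes and staying put is optimal; if
  \<open>x $ j = 0\<close>, only steps \<open>t \<ge> 0\<close> are feasible. Either way the optimal
  step is the positive part of the correlation.\<close>

lemma cmp_objective_eq:
  assumes x: "x \<in> nonneg_orthant" and compl: "x $ j = 0 \<or> col j \<bullet> (y - A *v x) = 0"
  shows "cmp_objective A nonneg_orthant y x j =
    (norm (y - A *v x))\<^sup>2 - (max (col j \<bullet> (y - A *v x)) 0)\<^sup>2"
proof -
  define r where "r = y - A *v x"
  define c where "c = col j \<bullet> r"
  have xj: "0 \<le> x $ j" using x by (simp add: nonneg_orthant_def)
  have val: "(norm (y - A *v (x + t *\<^sub>R axis j 1)))\<^sup>2 = (norm r)\<^sup>2 - 2 * t * c + t\<^sup>2" for t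
    using norm_diff_scaleR_square[OF norm_column, of r t j]
    by (simp add: matrix_vector_right_distrib matrix_vector_mult_scaleR
          matrix_vector_mult_basis r_def c_def
        algebra_simps)
  have feasible: "x + t *\<^sub>R axis j 1 \<in> nonneg_orthant \<longleftrightarrow> - x $ j \<le> t" for t
  proof -
    have "0 \<le> (x + t *\<^sub>R axis j 1) $ i \<longleftrightarrow> i \<noteq> j \<or> - x $ j \<le> t" for i
      using x by (auto simp: nonneg_orthant_def axis_def)
    then show ?thesis by (auto simp: nonneg_orthant_def)
  qed
  have "Inf {(norm r)\<^sup>2 - 2 * t * c + t\<^sup>2 | t. - x $ j \<le> t} = (norm r)\<^sup>2 - (max c 0)\<^sup>2"
  proof (rule cInf_eq_minimum)
    show "(norm r)\<^sup>2 - (max c 0)\<^sup>2 \<in> {(norm r)\<^sup>2 - 2 * t * c + t\<^sup>2 | t. - x $ j \<le> t}"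
      using xj by (intro CollectI exI[of _ "max c 0"]) (auto simp: max_def power2_eq_square)
    fix z assume "z \<in> {(norm r)\<^sup>2 - 2 * t * c + t\<^sup>2 | t. - x $ j \<le> t}"
    then obtain t where t: "- x $ j \<le> t" and z: "z = (norm r)\<^sup>2 - 2 * t * c + t\<^sup>2" by blast
    show "(norm r)\<^sup>2 - (max c 0)\<^sup>2 \<le> z"
    proof (cases "c \<ge> 0")
      case True
      have "0 \<le> (t - c)\<^sup>2" by simp
      then show ?thesis using True by (simp add: z power2_diff algebra_simps)
    next
      case False
      then have "0 \<le> t" using compl t by (auto simp: c_def r_def)
      then have "t * c \<le> 0" using False by (simp add: mult_nonneg_nonpos)
      then have "0 \<le> t\<^sup>2 - 2 * (t * c)" using zero_le_power2[of t] by linarith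
      then show ?thesis using False by (simp add: z algebra_simps)
    qed
  qed
  then show ?thesis
    by (simp add: cmp_objective_def val feasible r_def c_def)
qed

lemma is_arg_min_cmp_objective_iff:
  assumes "x \<in> nonneg_orthant" and "\<And>i. x $ i = 0 \<or> col i \<bullet> (y - A *v x) = 0"
  shows "is_arg_min (cmp_objective A nonneg_orthant y x) (\<lambda>_. True) j \<longleftrightarrow>
    (\<forall>i. max (col i \<bullet> (y - A *v x)) 0 \<le> max (col j \<bullet> (y - A *v x)) 0)"
  by (simp add: is_arg_min_linorder cmp_objective_eq assms power_mono_iff)

text \<open>Strictness matters because a tie with an outside index could be resolved against
  \<open>S\<close>. The witness may depend on \<open>i\<close>, but by finiteness one best index of
  \<open>S\<close> then beats all outside ones.\<close>

definition dominant_on :: "'n set \<Rightarrow> real^'m \<Rightarrow> bool"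
  where "dominant_on S r \<longleftrightarrow> (\<forall>i\<in>-S. \<exists>k\<in>S. max (col i \<bullet> r) 0 < col k \<bullet> r)"

lemma dominant_onD:
  assumes "dominant_on S r" "S \<noteq> UNIV" "\<And>i. max (col i \<bullet> r) 0 \<le> max (col j \<bullet> r) 0"
  shows "j \<in> S" "0 < col j \<bullet> r" "col i \<bullet> r \<le> col j \<bullet> r"
proof -
  obtain i0 where "i0 \<in> - S" using assms(2) by blast
  then obtain k where k: "max (col i0 \<bullet> r) 0 < col k \<bullet> r"
    using assms(1) by (auto simp: dominant_on_def)
  show pos: "0 < col j \<bullet> r" using k assms(3)[of k] by linarith
  show "col i \<bullet> r \<le> col j \<bullet> r" using pos assms(3)[of i] by linarith
  show "j \<in> S"
  proof (rule ccontr)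
    assume "j \<notin> S"
    then obtain k where "max (col j \<bullet> r) 0 < col k \<bullet> r"
      using assms(1) by (auto simp: dominant_on_def)
    then show False using assms(3)[of k] by linarith
  qed
qed

text \<open>Some outside index \<open>i0\<close> is beaten by no index of \<open>S\<close>. The best
  outside index is at least as good as \<open>i0\<close>, hence maximal overall, and the algorithm
  may select it.\<close>

lemma not_dominant_onD:
  assumes "\<not> dominant_on S r"
  shows "\<exists>j. j \<notin> S \<and> (\<forall>i. max (col i \<bullet> r) 0 \<le> max (col j \<bullet> r) 0)"
proof -
  obtain i0 where i0: "i0 \<notin> S" "\<And>k. k \<in> S \<Longrightarrow> col k \<bullet> r \<le> max (col i0 \<bullet> r) 0"
    using assms by (force simp: dominant_on_def not_less)
  have "\<exists>j\<in>-S. \<forall>i\<in>-S. max (col i \<bullet> r) 0 \<le> max (col j \<bullet> r) 0"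
    using i0(1) ex_is_arg_min_if_finite[of "- S" "\<lambda>i. - max (col i \<bullet> r) 0"]
    by (auto simp: is_arg_min_linorder)
  then obtain j where j: "j \<in> - S" "\<And>i. i \<in> - S \<Longrightarrow> max (col i \<bullet> r) 0 \<le> max (col j \<bullet> r) 0"
    by blast
  have "max (col i \<bullet> r) 0 \<le> max (col j \<bullet> r) 0" for i
  proof (cases "i \<in> S")
    case True
    then have "col i \<bullet> r \<le> max (col i0 \<bullet> r) 0" by (rule i0(2))
    moreover have "max (col i0 \<bullet> r) 0 \<le> max (col j \<bullet> r) 0" using i0(1) j(2) by simp
    ultimately show ?thesis by linarith
  qed (use j in simp)
  then show ?thesis using j(1) by auto
qed

section \<open>Runs of the algorithm\<close>

text \<open>A relation on states, so that its relational powers describe finite prefixes under every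
  resolution of ties.\<close>

definition step :: "real^'m \<Rightarrow> (real^'n) \<times> 'n set \<Rightarrow> (real^'n) \<times> 'n set \<Rightarrow> bool"
  where "step y \<sigma> \<tau> \<longleftrightarrow>
    (\<exists>j. is_arg_min (cmp_objective A nonneg_orthant y (fst \<sigma>)) (\<lambda>_. True) j \<and>
      snd \<tau> = insert j (snd \<sigma>) \<and> cmp_solution A nonneg_orthant y (snd \<tau>) (fst \<tau>))"

lemma cmp_sequence_iff_step:
  "cmp_sequence A nonneg_orthant y x J \<longleftrightarrow>
    (x 0, J 0) = (0, {}) \<and> (\<forall>k. step y (x k, J k) (x (Suc k), J (Suc k)))"
proof -
  have "(x 0, J 0) = (0, {}) \<longleftrightarrow> x 0 = 0 \<and> J 0 = {}" by (rule prod.inject)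
  moreover have "step y (x k, J k) (x (Suc k), J (Suc k)) \<longleftrightarrow>
      (\<exists>j. is_arg_min (cmp_objective A nonneg_orthant y (x k)) (\<lambda>_. True) j \<and>
        J (Suc k) = insert j (J k) \<and> cmp_solution A nonneg_orthant y (J (Suc k)) (x (Suc k)))" for k
    unfolding step_def fst_conv snd_conv ..
  ultimately show ?thesis unfolding cmp_sequence_def by blast
qed

lemma step_exists: "\<exists>\<tau>. step y \<sigma> \<tau>"
proof -
  obtain j where "is_arg_min (cmp_objective A nonneg_orthant y (fst \<sigma>)) (\<lambda>_. True) j"
    using ex_is_arg_min_if_finite[of UNIV "cmp_objective A nonneg_orthant y (fst \<sigma>)"]
    by (auto simp: is_arg_min_def)
  moreover obtain w where "cmp_solution A nonneg_orthant y (insert j (snd \<sigma>)) w"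
    using cmp_solution_exists by blast
  ultimately show ?thesis by (auto simp: step_def)
qed

lemma run_exists: "\<exists>f. f 0 = \<sigma> \<and> (\<forall>k. step y (f k) (f (Suc k)))"
proof -
  have "\<exists>f. \<forall>n. (n = 0 \<longrightarrow> f n = \<sigma>) \<and> step y (f n) (f (Suc n))"
    by (rule dependent_nat_choice) (use step_exists in blast)+
  then show ?thesis by blast
qed

text \<open>Recovery speaks of infinite sequences only, so a finite prefix has to be prolonged
  before recovery can be applied to it.\<close>

lemma run_through:
  assumes "(step y ^^ n) \<sigma> \<tau>"
  shows "\<exists>f. f 0 = \<sigma> \<and> (\<forall>k. step y (f k) (f (Suc k))) \<and> f n = \<tau>"
  using assms
proof (induction n arbitrary: \<sigma>)
  case 0
  then have "\<sigma> = \<tau>" by simp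
  obtain f where "f 0 = \<sigma>" "\<forall>k. step y (f k) (f (Suc k))" using run_exists by blast
  then show ?case using \<open>\<sigma> = \<tau>\<close> by (intro exI[of _ f]) simp
next
  case (Suc n)
  then obtain \<rho> where \<rho>: "step y \<sigma> \<rho>" "(step y ^^ n) \<rho> \<tau>"
    by (meson relpowp_Suc_E2)
  then obtain f where f: "f 0 = \<rho>" "\<forall>k. step y (f k) (f (Suc k))" "f n = \<tau>"
    using Suc.IH by blast
  show ?case
    using f \<rho>(1) by (intro exI[of _ "case_nat \<sigma> f"]) (auto split: nat.split)
qed

lemma run_mono:
  assumes "\<forall>k. step y (f k) (f (Suc k))" "k \<le> l"
  shows "snd (f k) \<subseteq> snd (f l)"
proof (rule lift_Suc_mono_le[of "\<lambda>k. snd (f k)", OF _ assms(2)])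
  show "snd (f i) \<subseteq> snd (f (Suc i))" for i
    using assms(1)[rule_format, of i] unfolding step_def by blast
qed

lemma card_run_le:
  assumes "\<forall>k. step y (f k) (f (Suc k))" "f 0 = (0, {})"
  shows "card (snd (f k)) \<le> k"
proof (induction k)
  case (Suc k)
  obtain j where "snd (f (Suc k)) = insert j (snd (f k))"
    using assms(1)[rule_format, of k] unfolding step_def by blast
  then show ?case using Suc card_insert_le_m1[of "Suc k" "snd (f k)" j] by simp
qed (simp add: assms)

text \<open>Each step adds at most one index, so \<open>supp z\<close> is not reached before step
  \<open>card (supp z)\<close>; monotonicity then confines the index sets up to that step.\<close>

lemma run_within:
  assumes rec: "cmp_recovered A nonneg_orthant z"
    and reach: "(step (A *v z) ^^ n) (0, {}) \<tau>" and n: "n \<le> card (supp z)"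
  shows "snd \<tau> \<subseteq> supp z"
proof -
  obtain f where f: "f 0 = (0, {})" "\<forall>k. step (A *v z) (f k) (f (Suc k))" "f n = \<tau>"
    using run_through[OF reach] by blast
  have "cmp_sequence A nonneg_orthant (A *v z) (fst \<circ> f) (snd \<circ> f)"
    using f by (simp add: cmp_sequence_iff_step del: prod.inject)
  then obtain s where s: "snd (f s) = supp z" using rec unfolding cmp_recovered_def comp_def by blast
  have "card (supp z) \<le> s" using card_run_le[OF f(2,1), of s] s by simp
  then show ?thesis using run_mono[OF f(2), of n s] n s f(3) by simp
qed

lemma stepI:
  assumes "x \<in> nonneg_orthant" "\<And>i. x $ i = 0 \<or> col i \<bullet> (y - A *v x) = 0"
    and "\<And>i. max (col i \<bullet> (y - A *v x)) 0 \<le> max (col j \<bullet> (y - A *v x)) 0"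
    and "cmp_solution A nonneg_orthant y (insert j J) w"
  shows "step y (x, J) (w, insert j J)"
  using is_arg_min_cmp_objective_iff[OF assms(1,2), of j] assms(3,4) by (auto simp: step_def)

text \<open>Selected indices are never dropped, so an index outside the support must not be selected
  before the stage at which the support can first be reached.\<close>

lemma dominant_on_residual:
  assumes rec: "cmp_recovered A nonneg_orthant z"
    and reach: "(step (A *v z) ^^ n) (0, {}) (x, J)" and n: "n < card (supp z)"
    and x: "x \<in> nonneg_orthant" "\<And>i. x $ i = 0 \<or> col i \<bullet> (A *v z - A *v x) = 0"
  shows "dominant_on (supp z) (A *v z - A *v x)"
proof (rule ccontr)
  assume "\<not> ?thesis"
  then obtain j where j: "j \<notin> supp z"
    "\<And>i. max (col i \<bullet> (A *v z - A *v x)) 0 \<le> max (col j \<bullet> (A *v z - A *v x)) 0"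
    using not_dominant_onD by blast
  obtain w where "cmp_solution A nonneg_orthant (A *v z) (insert j J) w"
    using cmp_solution_exists by blast
  then have "step (A *v z) (x, J) (w, insert j J)" using x j(2) by (intro stepI)
  then have "(step (A *v z) ^^ Suc n) (0, {}) (w, insert j J)" using reach by auto
  from run_within[OF rec this] show False using n j(1) by auto
qed

section \<open>Geometry of two and three unit columns\<close>

abbreviation \<theta> :: "'n \<Rightarrow> 'n \<Rightarrow> real" where "\<theta> i j \<equiv> col i \<bullet> col j"

text \<open>Full column rank as a trivial kernel on vectors supported in \<open>S\<close>, which
  needs no enumeration of \<open>S\<close>.\<close>

definition independent_columns :: "'n set \<Rightarrow> bool"
  where "independent_columns S \<longleftrightarrow> (\<forall>w. supp w \<subseteq> S \<and> A *v w = 0 \<longrightarrow> w = 0)"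

text \<open>A multiple of the component of column \<open>t\<close> orthogonal to the columns \<open>p\<close> and \<open>q\<close>, scaled
  to avoid division.\<close>

definition proj_residual :: "'n \<Rightarrow> 'n \<Rightarrow> 'n \<Rightarrow> real^'m"
  where "proj_residual p q t = (1 - (\<theta> p q)\<^sup>2) *\<^sub>R col t
    - (\<theta> p t - \<theta> p q * \<theta> q t) *\<^sub>R col p - (\<theta> q t - \<theta> p q * \<theta> p t) *\<^sub>R col q"

lemma matrix_vector_mult_three:
  assumes "distinct [p, q, t]" "supp w \<subseteq> {p, q, t}"
  shows "A *v w = w $ p *\<^sub>R col p + w $ q *\<^sub>R col q + w $ t *\<^sub>R col t"
proof -
  have "A *v w = (\<Sum>i\<in>UNIV. w $ i *\<^sub>R col i)"
    by (simp add: matrix_mult_sum scalar_mult_eq_scaleR)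
  also have "\<dots> = (\<Sum>i\<in>{p, q, t}. w $ i *\<^sub>R col i)"
    using assms(2) by (intro sum.mono_neutral_right) (auto simp: supp_def)
  finally show ?thesis using assms(1) by (simp add: add.assoc)
qed

text \<open>\<open>1 - (\<theta> p q)\<^sup>2\<close> is the squared distance of column
  \<open>p\<close> from the line spanned by column \<open>q\<close>.\<close>

lemma \<theta>_square_less_1:
  assumes "independent_columns S" "p \<in> S" "q \<in> S" "p \<noteq> q"
  shows "(\<theta> p q)\<^sup>2 < 1"
proof -
  let ?w = "axis p 1 - \<theta> p q *\<^sub>R axis q (1::real)"
  have Aw: "A *v ?w = col p - \<theta> p q *\<^sub>R col q"
    by (simp add: matrix_vector_mult_diff_distrib matrix_vector_mult_scaleR
        matrix_vector_mult_basis)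
  have "?w $ p \<noteq> 0" using assms(4) by (simp add: axis_def)
  then have "?w \<noteq> 0" by (metis zero_index)
  moreover have "supp ?w \<subseteq> S" using assms by (auto simp: supp_def axis_def split: if_splits)
  ultimately have "col p - \<theta> p q *\<^sub>R col q \<noteq> 0"
    using assms(1) Aw unfolding independent_columns_def by metis
  then have "0 < (norm (col p - \<theta> p q *\<^sub>R col q))\<^sup>2" by simp
  also have "\<dots> = 1 - (\<theta> p q)\<^sup>2"
    unfolding norm_diff_scaleR_square[OF norm_column]
    by (simp add: norm_column inner_commute power2_eq_square)
  finally show ?thesis by simp
qed

lemma \<theta>_less_1:
  assumes "independent_columns S" "p \<in> S" "q \<in> S" "p \<noteq> q"
  shows "\<theta> p q < 1"
proof -
  have "(\<theta> p q)\<^sup>2 < 1\<^sup>2" using \<theta>_square_less_1[OF assms] by simp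
  then show ?thesis by (rule power2_less_imp_less) simp
qed

text \<open>The third value is the Gram determinant of the three columns.\<close>

lemma inner_proj_residual:
  "col p \<bullet> proj_residual p q t = 0"
  "col q \<bullet> proj_residual p q t = 0"
  "col t \<bullet> proj_residual p q t =
    1 + 2 * \<theta> p q * \<theta> p t * \<theta> q t - (\<theta> p q)\<^sup>2 - (\<theta> p t)\<^sup>2 - (\<theta> q t)\<^sup>2"
  by (simp_all add: proj_residual_def inner_diff_right inner_col_self
      inner_commute[of "col q" "col p"] inner_commute[of "col t"]
      power2_eq_square algebra_simps)

text \<open>The two orthogonality conditions form a linear system for \<open>a\<close> and
  \<open>b\<close> with determinant \<open>1 - (\<theta> p q)\<^sup>2\<close>, whose solution is
  linear in \<open>u\<close>.\<close>

lemma proj_residual_unique: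
  assumes "r = a *\<^sub>R col p + b *\<^sub>R col q + u *\<^sub>R col t"
    and "col p \<bullet> r = 0" "col q \<bullet> r = 0"
  shows "(1 - (\<theta> p q)\<^sup>2) *\<^sub>R r = u *\<^sub>R proj_residual p q t"
proof -
  have e1: "a + b * \<theta> p q + u * \<theta> p t = 0"
    using assms(1,2) by (simp add: inner_add_right inner_col_self)
  have e2: "a * \<theta> p q + b + u * \<theta> q t = 0"
    using assms(1,3) by (simp add: inner_add_right inner_col_self inner_commute[of "col q" "col p"])
  have "(1 - (\<theta> p q)\<^sup>2) * a = - u * (\<theta> p t - \<theta> p q * \<theta> q t)"
    "(1 - (\<theta> p q)\<^sup>2) * b = - u * (\<theta> q t - \<theta> p q * \<theta> p t)"
    using e1 e2 by algebra+
  then show ?thesis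
    unfolding assms(1) proj_residual_def
    by (simp add: scaleR_add_right scaleR_diff_right mult.commute)
qed

text \<open>The residual is nonzero by independence, and its squared norm is the Gram determinant
  times the positive factor \<open>1 - (\<theta> p q)\<^sup>2\<close>.\<close>

lemma gram_det_pos:
  assumes "independent_columns S" "{p, q, t} \<subseteq> S" "distinct [p, q, t]"
  shows "0 < col t \<bullet> proj_residual p q t"
proof -
  define r where "r = proj_residual p q t"
  define w where "w = (1 - (\<theta> p q)\<^sup>2) *\<^sub>R axis t 1 - (\<theta> p t - \<theta> p q * \<theta> q t) *\<^sub>R axis p 1
    - (\<theta> q t - \<theta> p q * \<theta> p t) *\<^sub>R axis q (1::real)"
  have pos: "0 < 1 - (\<theta> p q)\<^sup>2" using \<theta>_square_less_1[OF assms(1), of p q] assms(2,3) by simp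
  have "w $ t \<noteq> 0" using pos assms(3) by (auto simp: w_def axis_def)
  then have "w \<noteq> 0" by (metis zero_index)
  moreover have "supp w \<subseteq> S"
    using assms(2) by (auto simp: w_def supp_def axis_def split: if_splits)
  moreover have "A *v w = r"
    by (simp add: w_def r_def proj_residual_def matrix_vector_mult_diff_distrib
        matrix_vector_mult_scaleR matrix_vector_mult_basis)
  ultimately have "r \<noteq> 0" using assms(1) unfolding independent_columns_def by metis
  then have "0 < r \<bullet> r" by simp
  also have "r \<bullet> r = (1 - (\<theta> p q)\<^sup>2) * (col t \<bullet> r)"
    unfolding r_def by (subst (1) proj_residual_def) (simp add: inner_diff_left inner_proj_residual)
  finally show ?thesis using pos by (simp add: zero_less_mult_iff r_def)
qed

lemma dominant_on_scaleR:
  assumes "0 < c"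
  shows "dominant_on S (c *\<^sub>R r) \<longleftrightarrow> dominant_on S r"
proof -
  have "max (c * a) 0 < c * b \<longleftrightarrow> max a 0 < b" for a b
    using assms by (simp add: zero_less_mult_iff)
  then show ?thesis by (simp add: dominant_on_def)
qed

lemma dominant_on_maximal:
  assumes "dominant_on S r" "\<And>k. k \<in> S \<Longrightarrow> col k \<bullet> r \<le> col j \<bullet> r"
  shows "max (col i \<bullet> r) 0 \<le> max (col j \<bullet> r) 0"
proof (cases "i \<in> S")
  case True
  then show ?thesis using assms(2)[of i] by auto
next
  case False
  then obtain k where "k \<in> S" "max (col i \<bullet> r) 0 < col k \<bullet> r"
    using assms(1) by (auto simp: dominant_on_def)
  then show ?thesis using assms(2)[of k] by linarith
qed

section \<open>Sufficiency\<close>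

text \<open>The residual of \<open>z\<close> is zero, so every minimizer reproduces
  \<open>A *v z\<close>, and independence identifies it.\<close>

lemma cmp_solution_supp_iff:
  assumes "independent_columns (supp z)" "z \<in> nonneg_orthant"
  shows "cmp_solution A nonneg_orthant (A *v z) (supp z) w \<longleftrightarrow> w = z"
proof
  assume w: "cmp_solution A nonneg_orthant (A *v z) (supp z) w"
  then have "(norm (A *v w - A *v z))\<^sup>2 \<le> (norm (A *v z - A *v z))\<^sup>2"
    using assms(2) unfolding cmp_solution_def is_arg_min_linorder by blast
  then have "A *v (w - z) = 0" by (simp add: matrix_vector_mult_diff_distrib)
  moreover have "supp (w - z) \<subseteq> supp z" using w by (auto simp: cmp_solution_iff_kkt supp_def)
  ultimately have "w - z = 0" using assms(1) unfolding independent_columns_def by blast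
  then show "w = z" by simp
qed (simp add: cmp_solution_iff_kkt assms)

text \<open>Three new selections inside \<open>S\<close> exhaust it. The premise inside
  \<open>dom2\<close> is available because a run violating it never selects \<open>q\<close> right
  after \<open>p\<close>.\<close>

lemma cmp_recovered_if:
  fixes z
  defines "S \<equiv> supp z"
  assumes z: "z \<in> nonneg_orthant" and card: "card S = 3" and proper: "S \<noteq> UNIV"
    and indep: "independent_columns S"
    and dom0: "dominant_on S (A *v z)"
    and dom1: "\<And>j. j \<in> S \<Longrightarrow> dominant_on S (A *v z - (col j \<bullet> (A *v z)) *\<^sub>R col j)"
    and dom2: "\<And>p q t. distinct [p, q, t] \<Longrightarrow> S = {p, q, t} \<Longrightarrow>
      \<theta> q t - \<theta> p q * \<theta> p t < 1 - (\<theta> p q)\<^sup>2 \<Longrightarrow> dominant_on S (proj_residual p q t)"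
  shows "cmp_recovered A nonneg_orthant z"
  unfolding cmp_recovered_def
proof (intro allI impI conjI)
  fix x :: "nat \<Rightarrow> real^'n" and J
  define y where "y = A *v z"
  define r where "r k = y - A *v x k" for k
  assume "cmp_sequence A nonneg_orthant (A *v z) x J"
  then have init: "x 0 = 0" "J 0 = {}"
    and seq: "\<exists>j. is_arg_min (cmp_objective A nonneg_orthant y (x k)) (\<lambda>_. True) j \<and>
      J (Suc k) = insert j (J k) \<and> cmp_solution A nonneg_orthant y (J (Suc k)) (x (Suc k))" for k
    unfolding cmp_sequence_def y_def by blast+
  have sol: "cmp_solution A nonneg_orthant y (J (Suc k)) (x (Suc k))" for k
    using seq[of k] by blast
  have kkt_all: "x k \<in> nonneg_orthant \<and> supp (x k) \<subseteq> J k \<and>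
      (\<forall>j\<in>J k. col j \<bullet> r k \<le> 0 \<and> (x k $ j = 0 \<or> col j \<bullet> r k = 0))" for k
  proof (cases k)
    case 0
    then show ?thesis by (simp add: init nonneg_orthant_def supp_def)
  next
    case (Suc l)
    then show ?thesis using sol[of l] unfolding cmp_solution_iff_kkt r_def by simp
  qed
  note nonneg = kkt_all[THEN conjunct1]
    and supp_x = kkt_all[THEN conjunct2, THEN conjunct1]
    and kkt = kkt_all[THEN conjunct2, THEN conjunct2, rule_format]
  have compl: "x k $ i = 0 \<or> col i \<bullet> (y - A *v x k) = 0" for i k
    using kkt[of i k] supp_x[of k] by (auto simp: supp_def r_def)
  \<comment> \<open>Optimality bounds the correlations on \<open>J k\<close> by 0, whereas under
    dominance the maximum is positive, so the selected index is new.\<close>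
  have "next": "\<exists>j\<in>S - J k. J (Suc k) = insert j (J k) \<and> 0 < col j \<bullet> r k \<and>
      (\<forall>i. col i \<bullet> r k \<le> col j \<bullet> r k)" if "dominant_on S (r k)" for k
  proof -
    obtain j where j: "is_arg_min (cmp_objective A nonneg_orthant y (x k)) (\<lambda>_. True) j"
      "J (Suc k) = insert j (J k)" using seq[of k] by blast
    have "\<And>i. max (col i \<bullet> r k) 0 \<le> max (col j \<bullet> r k) 0"
      using j(1) is_arg_min_cmp_objective_iff[OF nonneg compl] by (simp add: r_def)
    note D = dominant_onD[OF that proper this]
    show ?thesis
    proof (intro bexI[of _ j] conjI allI)
      show "j \<in> S - J k" using D(1,2) kkt[of j k] by auto
    qed (use D(2,3) j(2) in auto)
  qed
  have r0: "r 0 = y" by (simp add: r_def init)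
  with dom0 "next"[of 0] init obtain p where p: "p \<in> S" "J 1 = {p}" "0 < col p \<bullet> y"
    by (auto simp: y_def)
  \<comment> \<open>Orthogonality forces \<open>x'\<close> to be \<open>col j \<bullet> y\<close>,
    so \<open>dom1\<close> applies. This serves the first iterate and also a second iterate on the
    boundary.\<close>
  have single: "dominant_on S (y - x' *\<^sub>R col j)"
    if "j \<in> S" "col j \<bullet> (y - x' *\<^sub>R col j) = 0" for j x'
    using dom1[of j] that by (simp add: inner_diff_right inner_col_self y_def)
  have r1: "r 1 = y - x 1 $ p *\<^sub>R col p"
  proof -
    have "x 1 = x 1 $ p *\<^sub>R axis p 1"
      using supp_x[of 1] p(2) by (auto simp: vec_eq_iff axis_def supp_def)
    then show ?thesis
      unfolding r_def by (metis matrix_vector_mult_basis matrix_vector_mult_scaleR)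
  qed
  \<comment> \<open>A zero coefficient would leave the residual \<open>y\<close>, and optimality on
    \<open>{p}\<close> would contradict \<open>p(3)\<close>.\<close>
  have "x 1 $ p \<noteq> 0" using kkt[of p 1] p r1 by auto
  then have "col p \<bullet> r 1 = 0" using kkt[of p 1] p by auto
  then have orth1: "col p \<bullet> y = x 1 $ p"
    unfolding r1 by (simp add: inner_diff_right inner_col_self)
  have "dominant_on S (r 1)"
    unfolding r1 by (rule single[OF p(1)]) (use \<open>col p \<bullet> r 1 = 0\<close> r1 in simp)
  from "next"[OF this] obtain q where "q \<in> S - J 1" "J (Suc 1) = insert q (J 1)"
    and best: "\<And>i. col i \<bullet> r 1 \<le> col q \<bullet> r 1" by blast
  then have q: "q \<in> S" "q \<noteq> p" "J 2 = {p, q}" using p(2) by (auto simp: numeral_2_eq_2)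
  have "card (S - {p, q}) = 1" using card p(1) q(1,2) by (simp add: card_Diff_subset)
  then obtain t where "S - {p, q} = {t}" by (rule card_1_singletonE)
  then have S: "S = {p, q, t}" and dist: "distinct [p, q, t]" using p(1) q(1,2) by auto
  have y: "y = z $ p *\<^sub>R col p + z $ q *\<^sub>R col q + z $ t *\<^sub>R col t"
    unfolding y_def using dist S by (intro matrix_vector_mult_three) (auto simp: S_def)
  have "A *v x 2 = x 2 $ p *\<^sub>R col p + x 2 $ q *\<^sub>R col q + x 2 $ t *\<^sub>R col t"
    using supp_x[of 2] q(3) by (intro matrix_vector_mult_three[OF dist]) auto
  moreover have "x 2 $ t = 0" using supp_x[of 2] q(3) dist by (auto simp: supp_def)
  ultimately have r2: "r 2 = y - x 2 $ p *\<^sub>R col p - x 2 $ q *\<^sub>R col q"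
    by (simp add: r_def)
  have posz: "0 < z $ i" if "i \<in> S" for i
    using z that by (force simp: nonneg_orthant_def S_def supp_def less_le)
  have det2: "0 < 1 - (\<theta> p q)\<^sup>2" using \<theta>_square_less_1[OF indep, of p q] S dist by simp
  have "dominant_on S (r 2)"
  proof (cases "x 2 $ p = 0 \<or> x 2 $ q = 0")
    case True
    \<comment> \<open>As for the first iterate, the residual cannot still be \<open>y\<close>; hence
      exactly one coefficient vanishes in this case.\<close>
    have "x 2 $ p \<noteq> 0 \<or> x 2 $ q \<noteq> 0" using kkt[of p 2] p(3) q(3) r2 by auto
    then show ?thesis
      using True kkt[of p 2] kkt[of q 2] q(3) single[OF p(1)] single[OF q(1)] r2 by auto
  next
    case False
    then have orth: "col p \<bullet> r 2 = 0" "col q \<bullet> r 2 = 0" using kkt[of p 2] kkt[of q 2] q(3) by auto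
    have "r 2 = (z $ p - x 2 $ p) *\<^sub>R col p + (z $ q - x 2 $ q) *\<^sub>R col q + z $ t *\<^sub>R col t"
      by (simp add: r2 y scaleR_diff_left algebra_simps)
    from proj_residual_unique[OF this orth]
    have scaled: "(1 - (\<theta> p q)\<^sup>2) *\<^sub>R r 2 = z $ t *\<^sub>R proj_residual p q t" .
    have "\<theta> q t - \<theta> p q * \<theta> p t < 1 - (\<theta> p q)\<^sup>2"
    \<comment> \<open>Otherwise, after \<open>p\<close>, index \<open>t\<close> would have been strictly preferred to \<open>q\<close>.\<close>
    proof (rule ccontr)
      define d where "d = 1 - (\<theta> p q)\<^sup>2"
      define e where "e = \<theta> q t - \<theta> p q * \<theta> p t"
      assume "\<not> \<theta> q t - \<theta> p q * \<theta> p t < 1 - (\<theta> p q)\<^sup>2"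
      then have de: "d \<le> e" by (simp add: d_def e_def)
      have c1: "col q \<bullet> r 1 = d * z $ q + e * z $ t"
        "col t \<bullet> r 1 = e * z $ q + (1 - (\<theta> p t)\<^sup>2) * z $ t"
        unfolding r1 orth1[symmetric] d_def e_def y
        by (simp_all add: inner_diff_right inner_add_right inner_col_self
            inner_commute[of "col q" "col p"] inner_commute[of "col t"] power2_eq_square
            algebra_simps)
      \<comment> \<open>\<open>d * (1 - (\<theta> p t)\<^sup>2) - e * e\<close> is the Gram
        determinant, hence positive. The resulting bound on \<open>e\<close> makes column
        \<open>t\<close> strictly better correlated with \<open>r 1\<close> than column
        \<open>q\<close>, contrary to \<open>best\<close>.\<close>
      have "d * e \<le> e * e" using de det2 by (intro mult_right_mono) (auto simp: d_def)
      also have "e * e < d * (1 - (\<theta> p t)\<^sup>2)"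
        using gram_det_pos[OF indep _ dist] S
        by (simp add: inner_proj_residual d_def e_def power2_eq_square algebra_simps)
      finally have "e < 1 - (\<theta> p t)\<^sup>2" using det2 by (simp add: d_def)
      then have "e * z $ t < (1 - (\<theta> p t)\<^sup>2) * z $ t" using posz[of t] S by simp
      moreover have "d * z $ q \<le> e * z $ q" using de posz[of q] S by simp
      ultimately show False using best[of t] c1 by linarith
    qed
    then have "dominant_on S (proj_residual p q t)" by (rule dom2[OF dist S])
    then show ?thesis
      using dominant_on_scaleR[of "z $ t" S "proj_residual p q t"] dominant_on_scaleR[OF det2, of S "r 2"]
        posz[of t] scaled S by simp
  qed
  from "next"[OF this] obtain t' where "t' \<in> S - J 2" "J (Suc 2) = insert t' (J 2)" by blast
  then have "J 3 = S" using S q(3) by (auto simp: numeral_3_eq_3 numeral_2_eq_2)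
  then show "\<exists>s. J s = supp z" by (auto simp: S_def)
  fix s assume s: "J s = supp z"
  show iff: "cmp_solution A nonneg_orthant (A *v z) (J s) w \<longleftrightarrow> w = z" for w
    unfolding s by (rule cmp_solution_supp_iff) (use indep z in \<open>simp_all add: S_def\<close>)
  \<comment> \<open>The initial iterate is not a solution of a least squares problem by definition,
    so stage 0 has to be excluded.\<close>
  have "0 < s" using s init(2) p(1) by (cases s) (auto simp: S_def)
  then show "x s = z" using sol[of "s - 1"] iff by (simp add: y_def)
qed

section \<open>Necessity\<close>

text \<open>A nonzero kernel vector supported in \<open>S\<close> would give a second minimizer
  beside the indicator vector of \<open>S\<close>.\<close>

lemma independent_columns_if_recovered:
  assumes rec: "\<And>z. z \<in> nonneg_orthant \<Longrightarrow> supp z = S \<Longrightarrow> cmp_recovered A nonneg_orthant z"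
  shows "independent_columns S"
  unfolding independent_columns_def
proof (intro allI impI)
  fix w :: "real^'n" assume w: "supp w \<subseteq> S \<and> A *v w = 0"
  define z :: "real^'n" where "z = (\<chi> i. if i \<in> S then 1 else 0)"
  have z: "z \<in> nonneg_orthant" "supp z = S" by (auto simp: z_def nonneg_orthant_def supp_def)
  \<comment> \<open>Normalization makes every entry of the perturbation at least -1, so
    \<open>z'\<close> stays nonnegative. For \<open>w = 0\<close> the quotient is 0 and
    \<open>z' = z\<close>.\<close>
  define z' where "z' = z + (1 / norm w) *\<^sub>R w"
  have w_bound: "- 1 \<le> w $ i / norm w" for i
    using component_le_norm_cart[of w i] by (cases "w = 0") (auto simp: le_divide_eq)
  have "0 \<le> z' $ i" for i
  proof (cases "i \<in> S")
    case True
    then show ?thesis using w_bound[of i] by (simp add: z'_def z_def)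
  next
    case False
    then have "w $ i = 0" using w by (auto simp: supp_def)
    then show ?thesis using False by (simp add: z'_def z_def)
  qed
  then have z'_nonneg: "z' \<in> nonneg_orthant" by (simp add: nonneg_orthant_def)
  have z'_supp: "supp z' \<subseteq> S" using w by (force simp: z'_def z_def supp_def)
  have "A *v z' = A *v z"
    using w by (simp add: z'_def matrix_vector_right_distrib matrix_vector_mult_scaleR)
  then have sol: "cmp_solution A nonneg_orthant (A *v z) S z'"
    using z'_nonneg z'_supp by (simp add: cmp_solution_iff_kkt)
  obtain f where f: "f 0 = (0, {})" "\<forall>k. step (A *v z) (f k) (f (Suc k))"
    using run_exists by blast
  then have run: "cmp_sequence A nonneg_orthant (A *v z) (fst \<circ> f) (snd \<circ> f)"
    by (simp add: cmp_sequence_iff_step del: prod.inject)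
  obtain s where "(snd \<circ> f) s = supp z"
    "\<forall>w. cmp_solution A nonneg_orthant (A *v z) ((snd \<circ> f) s) w \<longleftrightarrow> w = z"
    using rec[OF z, unfolded cmp_recovered_def, THEN spec, THEN spec, THEN mp, OF run] by blast
  then have "z' = z" using sol z(2) by simp
  then show "w = 0" by (simp add: z'_def)
qed

lemma dominant_on_0:
  assumes "cmp_recovered A nonneg_orthant z" "z \<noteq> 0"
  shows "dominant_on (supp z) (A *v z)"
proof -
  have "0 < card (supp z)" using assms(2) by (auto simp: card_gt_0_iff supp_def vec_eq_iff)
  then have "dominant_on (supp z) (A *v z - A *v 0)"
    using assms(1) by (intro dominant_on_residual[where n = 0 and J = "{}"])
      (simp_all add: nonneg_orthant_def)
  then show ?thesis by simp
qed

text \<open>Dominance makes the maximal correlation positive, so the projection of \<open>y\<close>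
  on column \<open>j\<close> is feasible and solves the constrained problem.\<close>

lemma first_step:
  assumes "dominant_on S y" "S \<noteq> UNIV" "\<And>k. k \<in> S \<Longrightarrow> col k \<bullet> y \<le> col j \<bullet> y"
  defines "x \<equiv> (col j \<bullet> y) *\<^sub>R axis j 1"
  shows "(step y ^^ 1) (0, {}) (x, {j})" "x \<in> nonneg_orthant"
    "\<And>i. x $ i = 0 \<or> col i \<bullet> (y - A *v x) = 0" "A *v x = (col j \<bullet> y) *\<^sub>R col j"
proof -
  have max: "\<And>i. max (col i \<bullet> y) 0 \<le> max (col j \<bullet> y) 0"
    by (rule dominant_on_maximal[OF assms(1,3)])
  have pos: "0 < col j \<bullet> y" by (rule dominant_onD(2)[OF assms(1,2) max])
  show x: "x \<in> nonneg_orthant" using pos by (simp add: x_def nonneg_orthant_def axis_def)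
  show Ax: "A *v x = (col j \<bullet> y) *\<^sub>R col j"
    by (simp add: x_def matrix_vector_mult_scaleR matrix_vector_mult_basis)
  then have orth: "col j \<bullet> (y - A *v x) = 0" by (simp add: inner_diff_right inner_col_self)
  show "\<And>i. x $ i = 0 \<or> col i \<bullet> (y - A *v x) = 0"
    using orth by (auto simp: x_def axis_def)
  have "supp x \<subseteq> {j}" by (auto simp: x_def supp_def axis_def)
  then have "cmp_solution A nonneg_orthant y {j} x" using x orth by (simp add: cmp_solution_iff_kkt)
  then have "step y (0, {}) (x, {j})"
    using max by (intro stepI) (simp_all add: nonneg_orthant_def)
  then show "(step y ^^ 1) (0, {}) (x, {j})" by (simp add: eq_OO)
qed

text \<open>Adding a large multiple of \<open>axis j 1\<close> to \<open>x\<close> makes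
  \<open>j\<close> a possible first selection, and projecting out column \<open>j\<close> removes
  the added term again.\<close>

lemma dominant_on_1:
  assumes rec: "\<And>z. z \<in> nonneg_orthant \<Longrightarrow> supp z = S \<Longrightarrow> cmp_recovered A nonneg_orthant z"
    and "1 < card S" "S \<noteq> UNIV" and x: "x \<in> nonneg_orthant" "supp x = S" and j: "j \<in> S"
  shows "dominant_on S (A *v x - (col j \<bullet> (A *v x)) *\<^sub>R col j)"
proof -
  have indep: "independent_columns S" using rec by (rule independent_columns_if_recovered)
  \<comment> \<open>Raising the weight of \<open>j\<close> by \<open>K\<close> increases its lead
    over \<open>k\<close> by \<open>K * (1 - \<theta> k j)\<close>.\<close>
  obtain K where K: "0 < K"
    "\<And>k. k \<in> S - {j} \<Longrightarrow> col k \<bullet> (A *v x) - col j \<bullet> (A *v x) \<le> K * (1 - \<theta> k j)"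
    using ex_scale_dominating[of "S - {j}" "\<lambda>k. 1 - \<theta> k j"
        "\<lambda>k. col k \<bullet> (A *v x) - col j \<bullet> (A *v x)"] \<theta>_less_1[OF indep] j by force
  define z where "z = x + K *\<^sub>R axis j 1"
  have "0 < x $ j" using x j by (force simp: nonneg_orthant_def supp_def less_le)
  then have z: "z \<in> nonneg_orthant" "supp z = S"
    using x K(1) by (auto simp: z_def nonneg_orthant_def supp_def axis_def)
  have Az: "A *v z = A *v x + K *\<^sub>R col j"
    by (simp add: z_def matrix_vector_right_distrib matrix_vector_mult_scaleR
        matrix_vector_mult_basis)
  have "z \<noteq> 0" using z(2) j by (auto simp: supp_def)
  then have dom: "dominant_on S (A *v z)" using dominant_on_0[OF rec[OF z]] z(2) by simp
  have best: "col k \<bullet> (A *v z) \<le> col j \<bullet> (A *v z)" if "k \<in> S" for k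
    using K(2)[of k] that
    by (cases "k = j") (simp_all add: Az inner_add_right inner_col_self algebra_simps)
  note first = first_step[OF dom assms(3) best]
  have "dominant_on S (A *v z - (col j \<bullet> (A *v z)) *\<^sub>R col j)"
    using dominant_on_residual[OF rec[OF z] first(1) _ first(2,3)] assms(2) first(4) z(2) by simp
  moreover have "A *v z - (col j \<bullet> (A *v z)) *\<^sub>R col j = A *v x - (col j \<bullet> (A *v x)) *\<^sub>R col j"
    by (simp add: Az inner_add_right inner_col_self algebra_simps)
  ultimately show ?thesis by simp
qed

text \<open>With \<open>z\<^sub>p\<close> much larger than \<open>z\<^sub>q\<close> and \<open>z\<^sub>q\<close> much larger than \<open>z\<^sub>t\<close> the algorithm selects \<open>p\<close>
  first, then \<open>q\<close>, and the second iterate is interior.\<close>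

lemma dominant_on_2:
  assumes rec: "\<And>z. z \<in> nonneg_orthant \<Longrightarrow> supp z = S \<Longrightarrow> cmp_recovered A nonneg_orthant z"
    and "S \<noteq> UNIV" and S: "S = {p, q, t}" and dist: "distinct [p, q, t]"
    and less: "\<theta> q t - \<theta> p q * \<theta> p t < 1 - (\<theta> p q)\<^sup>2"
  shows "dominant_on S (proj_residual p q t)"
proof -
  define d where "d = 1 - (\<theta> p q)\<^sup>2"
  define e1 where "e1 = \<theta> p t - \<theta> p q * \<theta> q t"
  define e2 where "e2 = \<theta> q t - \<theta> p q * \<theta> p t"
  have indep: "independent_columns S" using rec by (rule independent_columns_if_recovered)
  have d: "0 < d" using \<theta>_square_less_1[OF indep, of p q] S dist by (simp add: d_def)
  have card: "card S = 3" using S dist by simp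
  \<comment> \<open>The first bound puts \<open>q\<close> at least level with \<open>t\<close> after
    \<open>p\<close>, where \<open>less\<close> makes the rate \<open>d - e2\<close> positive; the
    second makes the \<open>q\<close> entry of \<open>x2\<close> nonnegative.\<close>
  obtain K2 where K2: "0 < K2" "1 - (\<theta> p t)\<^sup>2 - e2 \<le> K2 * (d - e2)" "- e2 \<le> K2 * d"
    using ex_scale_dominating[of "{(1 - (\<theta> p t)\<^sup>2 - e2, d - e2), (- e2, d)}" snd fst] d less
    unfolding d_def e2_def by auto
  define c where "c k = col k \<bullet> (K2 *\<^sub>R col q + col t)" for k
  have \<theta>p: "\<theta> q p < 1" "\<theta> t p < 1" using \<theta>_less_1[OF indep] S dist by auto
  \<comment> \<open>The first two bounds keep \<open>q\<close> and \<open>t\<close> from beating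
    \<open>p\<close> at the start; the last makes the \<open>p\<close> entry of \<open>x2\<close>
    nonnegative.\<close>
  obtain K1 where K1: "0 < K1" "c q - c p \<le> K1 * (1 - \<theta> q p)" "c t - c p \<le> K1 * (1 - \<theta> t p)"
    "- e1 \<le> K1 * d"
    using ex_scale_dominating[of "{(c q - c p, 1 - \<theta> q p), (c t - c p, 1 - \<theta> t p), (- e1, d)}"
        snd fst] d \<theta>p by auto
  define z :: "real^'n" where "z = K1 *\<^sub>R axis p 1 + K2 *\<^sub>R axis q 1 + axis t 1"
  define y where "y = A *v z"
  have z: "z \<in> nonneg_orthant" "supp z = S"
    using K1(1) K2(1) dist S by (auto simp: z_def nonneg_orthant_def supp_def axis_def)
  have y: "y = K1 *\<^sub>R col p + K2 *\<^sub>R col q + col t"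
    by (simp add: y_def z_def matrix_vector_right_distrib matrix_vector_mult_scaleR
        matrix_vector_mult_basis)
  have "z \<noteq> 0" using z(2) S by (auto simp: supp_def)
  then have dom0: "dominant_on S y" using dominant_on_0[OF rec[OF z]] z(2) by (simp add: y_def)
  have cy: "col k \<bullet> y = K1 * \<theta> k p + c k" for k by (simp add: y c_def inner_add_right)
  have best0: "col k \<bullet> y \<le> col p \<bullet> y" if "k \<in> S" for k
    using that K1(2,3) unfolding cy S by (auto simp: inner_col_self algebra_simps)
  define x1 where "x1 = (col p \<bullet> y) *\<^sub>R axis p (1::real)"
  note first = first_step[OF dom0 assms(2) best0, folded x1_def]
  define r1 where "r1 = y - A *v x1"
  have dom1: "dominant_on S r1"
    using dominant_on_residual[OF rec[OF z], folded y_def, OF first(1) _ first(2,3)] z(2) card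
    by (simp add: r1_def)
  have r1: "r1 = y - (col p \<bullet> y) *\<^sub>R col p" by (simp add: r1_def first(4))
  have c1: "col p \<bullet> r1 = 0" "col q \<bullet> r1 = K2 * d + e2" "col t \<bullet> r1 = K2 * e2 + (1 - (\<theta> p t)\<^sup>2)"
    unfolding r1 d_def e2_def y
    by (simp_all add: inner_diff_right inner_add_right inner_col_self
        inner_commute[of "col q" "col p"] inner_commute[of "col t"] power2_eq_square
        algebra_simps)
  have "col k \<bullet> r1 \<le> col q \<bullet> r1" if "k \<in> S" for k
    using that K2(2,3) c1 unfolding S by (auto simp: algebra_simps)
  then have best1: "\<And>i. max (col i \<bullet> r1) 0 \<le> max (col q \<bullet> r1) 0"
    by (rule dominant_on_maximal[OF dom1])
  \<comment> \<open>The projection of \<open>y\<close> on the span of columns \<open>p\<close> and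
    \<open>q\<close>; column \<open>t\<close> contributes the coefficients \<open>e1 / d\<close> and
    \<open>e2 / d\<close>.\<close>
  define x2 where "x2 = (K1 + e1 / d) *\<^sub>R axis p 1 + (K2 + e2 / d) *\<^sub>R axis q (1::real)"
  have "0 \<le> (K1 * d + e1) / d" "0 \<le> (K2 * d + e2) / d" using K1(4) K2(3) d by simp_all
  then have "0 \<le> K1 + e1 / d" "0 \<le> K2 + e2 / d" using d by (simp_all add: add_divide_distrib)
  then have x2_nonneg: "x2 \<in> nonneg_orthant" by (simp add: x2_def nonneg_orthant_def axis_def)
  have x2_supp: "supp x2 \<subseteq> {p, q}" by (auto simp: x2_def supp_def axis_def)
  have "y - A *v x2 = col t - (e1 / d) *\<^sub>R col p - (e2 / d) *\<^sub>R col q"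
    by (simp add: y x2_def matrix_vector_right_distrib matrix_vector_mult_scaleR
        matrix_vector_mult_basis scaleR_add_left)
  also have "\<dots> = (1 / d) *\<^sub>R proj_residual p q t"
    using d by (simp add: proj_residual_def scaleR_diff_right flip: d_def e1_def e2_def)
  finally have r2: "y - A *v x2 = (1 / d) *\<^sub>R proj_residual p q t" .
  have orth: "col i \<bullet> (y - A *v x2) = 0" if "i \<in> {p, q}" for i
    using that unfolding r2 by (auto simp: inner_proj_residual)
  then have "cmp_solution A nonneg_orthant y (insert q {p}) x2"
    using x2_nonneg x2_supp by (simp add: cmp_solution_iff_kkt insert_commute)
  then have "step y (x1, {p}) (x2, insert q {p})"
    using first(2,3) best1 unfolding r1_def by (intro stepI)
  then have "(step y ^^ 2) (0, {}) (x2, insert q {p})"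
    using first(1) by (auto simp: numeral_2_eq_2)
  then have "dominant_on (supp z) (y - A *v x2)"
    unfolding y_def
  proof (rule dominant_on_residual[OF rec[OF z]])
    show "x2 $ i = 0 \<or> col i \<bullet> (A *v z - A *v x2) = 0" for i
      using orth x2_supp by (auto simp: supp_def y_def)
  qed (use card z(2) x2_nonneg in simp_all)
  then show ?thesis using d z(2) by (simp add: r2 dominant_on_scaleR)
qed

text \<open>Recovery is stated for all vectors with support \<open>S\<close> because the necessity
  of the later stages rests on recovering auxiliary vectors of this class.\<close>

lemma recovery_iff:
  assumes card: "card S = 3" and proper: "S \<noteq> UNIV"
  shows "(\<forall>z\<in>nonneg_orthant. supp z = S \<longrightarrow> cmp_recovered A nonneg_orthant z) \<longleftrightarrow>
    independent_columns S \<and>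
    (\<forall>z\<in>nonneg_orthant. supp z = S \<longrightarrow> dominant_on S (A *v z)) \<and>
    (\<forall>j\<in>S. \<forall>z\<in>nonneg_orthant. supp z = S \<longrightarrow>
      dominant_on S (A *v z - (col j \<bullet> (A *v z)) *\<^sub>R col j)) \<and>
    (\<forall>p q t. distinct [p, q, t] \<and> S = {p, q, t} \<and> \<theta> q t - \<theta> p q * \<theta> p t < 1 - (\<theta> p q)\<^sup>2 \<longrightarrow>
      dominant_on S (proj_residual p q t))"
  (is "?rec \<longleftrightarrow> ?cond")
proof
  assume ?rec
  then have rec: "\<And>z. z \<in> nonneg_orthant \<Longrightarrow> supp z = S \<Longrightarrow> cmp_recovered A nonneg_orthant z"
    by blast
  have "z \<noteq> 0" if "supp z = S" for z :: "real^'n" using that card by (auto simp: supp_def)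
  then show ?cond
    using independent_columns_if_recovered[of S] dominant_on_0 dominant_on_1[of S]
      dominant_on_2[of S] rec card proper by (intro conjI ballI allI impI; fastforce)
next
  assume ?cond
  then show ?rec
    using card proper by (intro ballI impI cmp_recovered_if) auto
qed

end

section \<open>Translation into matrix notation\<close>

lemma column_col_submat: "column k (col_submat A f) = column (f $ k) A"
  by (simp add: column_def col_submat_def)

lemma transpose_mult_component: "(transpose B *v r) $ i = column i B \<bullet> r"
  by (simp add: matrix_vector_mul_component column_def transpose_def row_def)

lemma submat_gram:
  "submat (transpose B ** B) f g = transpose (col_submat B f) ** col_submat B g"
  by (simp add: submat_def col_submat_def matrix_matrix_mult_def transpose_def vec_eq_iff)

text \<open>The eliminated block is the 1x1 identity, as its column has unit norm. The Schur
  complement of a Gram matrix is the Gram matrix of the remaining columns projected off the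
  eliminated one.\<close>

lemma schur_complement_gram_mult:
  fixes B :: "real^'a^'m" and J :: "'a^1" and I :: "'a^'k"
  assumes "norm (column (J $ 1) B) = 1"
  defines "b \<equiv> column (J $ 1) B" and "C \<equiv> col_submat B I" and "D \<equiv> col_submat B J"
  shows "(mat 1 - D ** transpose D) *v w = w - (b \<bullet> w) *\<^sub>R b"
    and "schur_complement (transpose B ** B) J I *v v =
      transpose C *v (C *v v - (b \<bullet> (C *v v)) *\<^sub>R b)"
proof -
  have D: "D *v x = (x $ 1) *\<^sub>R b" for x
    by (simp add: matrix_mult_sum scalar_mult_eq_scaleR column_col_submat D_def b_def)
  have Dt: "transpose D *v w = (\<chi> i. b \<bullet> w)" for w
    unfolding vec_eq_iff transpose_mult_component by (simp add: column_col_submat D_def b_def)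
  show proj: "(mat 1 - D ** transpose D) *v w = w - (b \<bullet> w) *\<^sub>R b" for w
    by (simp add: matrix_vector_mult_diff_rdistrib D Dt
        del: transpose_matrix_vector flip: matrix_vector_mul_assoc)
  have "(transpose D ** D) *v x = x" for x
    using assms(1) by (simp add: D Dt vec_eq_iff norm_eq_1 b_def
        del: transpose_matrix_vector flip: matrix_vector_mul_assoc)
  then have "transpose D ** D = mat 1" by (simp add: matrix_eq)
  moreover have "matrix_inv (mat 1) = (mat 1 :: real^1^1)"
    unfolding matrix_inv_def by (rule some_equality) auto
  ultimately have "schur_complement (transpose B ** B) J I *v v =
      transpose C *v (C *v v) - transpose C *v (D *v (transpose D *v (C *v v)))"
    by (simp add: schur_complement_def submat_gram matrix_vector_mult_diff_rdistrib
        del: transpose_matrix_vector flip: C_def D_def matrix_vector_mul_assoc)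
  then show "schur_complement (transpose B ** B) J I *v v =
      transpose C *v (C *v v - (b \<bullet> (C *v v)) *\<^sub>R b)"
    by (simp add: D Dt matrix_vector_mult_diff_distrib del: transpose_matrix_vector)
qed

text \<open>The maximum over \<open>- S\<close> is attained, so the witness \<open>h\<close> for a
  maximal outside index serves all of them.\<close>

lemma infnorm_on_pos_part_less_iff:
  fixes a :: "real^'a::finite" and b :: "real^'b::finite"
  assumes "S \<noteq> UNIV"
  shows "infnorm_on (- S) (pos_part a) < infnorm (pos_part b) \<longleftrightarrow>
    (\<forall>i\<in>-S. \<exists>h. max (a $ i) 0 < b $ h)"
proof -
  have ne: "- S \<noteq> {}" using assms by blast
  \<comment> \<open>The left side is nonnegative, so strict inequality forces \<open>y\<close> to be
    positive.\<close>
  have abs_max: "\<bar>max x 0\<bar> < \<bar>max y 0\<bar> \<longleftrightarrow> max x 0 < y" for x y :: real by auto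
  have max_less: "infnorm_on (- S) (pos_part a) < infnorm_on UNIV (pos_part b) \<longleftrightarrow>
      (\<exists>h. \<forall>i\<in>-S. \<bar>pos_part a $ i\<bar> < \<bar>pos_part b $ h\<bar>)"
    unfolding infnorm_on_def using ne by (simp add: Max_gr_iff)
  have swap: "(\<exists>h. \<forall>i\<in>-S. f i < g h) \<longleftrightarrow> (\<forall>i\<in>-S. \<exists>h. f i < g h)"
    for f :: "'a \<Rightarrow> real" and g :: "'b \<Rightarrow> real"
  proof
    assume *: "\<forall>i\<in>-S. \<exists>h. f i < g h"
    have "\<exists>i\<in>-S. \<forall>j\<in>-S. f j \<le> f i"
      using ne ex_is_arg_min_if_finite[of "- S" "\<lambda>i. - f i"] by (auto simp: is_arg_min_linorder)
    with * show "\<exists>h. \<forall>i\<in>-S. f i < g h" by (meson le_less_trans)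
  qed blast
  show ?thesis
    unfolding infnorm_on_UNIV[symmetric] max_less swap
    unfolding pos_part_def vec_lambda_beta abs_max ..
qed

text \<open>Summing over all preimages of \<open>i\<close> makes \<open>mult_extend_zero\<close>
  hold even when \<open>f\<close> repeats an index; for injective \<open>f\<close> this is extension
  by zero.\<close>

definition extend_zero :: "'n^'k \<Rightarrow> real^'k \<Rightarrow> real^'n"
  where "extend_zero f x = (\<chi> i. \<Sum>k\<in>UNIV. if f $ k = i then x $ k else 0)"

lemma mult_extend_zero:
  fixes A :: "real^'n^'m"
  shows "A *v extend_zero f x = col_submat A f *v x"
  unfolding vec_eq_iff matrix_vector_mult_def extend_zero_def col_submat_def
  by (simp add: sum_distrib_left if_distrib cong: if_cong) (subst sum.swap, simp)

lemma extend_zero_nth: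
  assumes "inj (($) f)"
  shows "extend_zero f x $ (f $ k) = x $ k"
proof -
  have "f $ l = f $ k \<longleftrightarrow> l = k" for l using assms by (auto simp: inj_def)
  then show ?thesis by (simp add: extend_zero_def)
qed

lemma extend_zero_restrict:
  assumes "inj (($) f)" "supp w \<subseteq> range (($) f)"
  shows "extend_zero f (\<chi> k. w $ (f $ k)) = w"
  unfolding vec_eq_iff
proof
  fix i show "extend_zero f (\<chi> k. w $ (f $ k)) $ i = w $ i"
  proof (cases "i \<in> range (($) f)")
    case True
    then show ?thesis using extend_zero_nth[OF assms(1)] by auto
  next
    case False
    then have "w $ i = 0" "\<And>k. f $ k \<noteq> i" using assms(2) by (auto simp: supp_def)
    then show ?thesis by (simp add: extend_zero_def)
  qed
qed

lemma supp_extend_zero: "supp (extend_zero f x) \<subseteq> range (($) f)"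
proof
  fix i assume "i \<in> supp (extend_zero f x)"
  then have "\<exists>k. f $ k = i"
    by (rule contrapos_pp) (simp add: supp_def extend_zero_def)
  then show "i \<in> range (($) f)" by auto
qed

text \<open>Extension by zero and restriction are mutually inverse between the positive orthant and
  the nonnegative vectors with this support.\<close>

lemma ball_full_support_iff:
  fixes A :: "real^'n^'m" and f :: "'n^'k"
  assumes f: "inj (($) f)"
  shows "(\<forall>z\<in>nonneg_orthant. supp z = range (($) f) \<longrightarrow> P (A *v z)) \<longleftrightarrow>
    (\<forall>u\<in>pos_orthant. P (col_submat A f *v u))"
proof safe
  fix u :: "real^'k" assume L: "\<forall>z\<in>nonneg_orthant. supp z = range (($) f) \<longrightarrow> P (A *v z)"
    and u: "u \<in> pos_orthant"
  have "0 \<le> extend_zero f u $ i" for i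
    unfolding extend_zero_def using u by (auto simp: pos_orthant_def less_imp_le intro!: sum_nonneg)
  moreover have "range (($) f) \<subseteq> supp (extend_zero f u)"
    using u by (auto simp: supp_def extend_zero_nth[OF f] pos_orthant_def less_le)
  ultimately show "P (col_submat A f *v u)"
    using L supp_extend_zero[of f u] by (auto simp: nonneg_orthant_def mult_extend_zero[symmetric])
next
  fix z :: "real^'n" assume R: "\<forall>u\<in>pos_orthant. P (col_submat A f *v u)"
    and z: "z \<in> nonneg_orthant" "supp z = range (($) f)"
  have "0 < z $ (f $ k)" for k
    using z by (force simp: nonneg_orthant_def supp_def less_le)
  then have "(\<chi> k. z $ (f $ k)) \<in> pos_orthant" by (simp add: pos_orthant_def)
  with R have "P (A *v extend_zero f (\<chi> k. z $ (f $ k)))" by (simp add: mult_extend_zero)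
  then show "P (A *v z)" using z by (simp add: extend_zero_restrict f)
qed

section \<open>Rank, Gram determinant and Schur complement conditions\<close>

context unit_column_matrix
begin

lemma independent_columns_iff_rank:
  fixes f :: "'n^'k"
  assumes f: "inj (($) f)"
  shows "independent_columns (range (($) f)) \<longleftrightarrow> rank (col_submat A f) = CARD('k)"
proof -
  have "rank (col_submat A f) = CARD('k) \<longleftrightarrow> (\<forall>x. col_submat A f *v x = 0 \<longrightarrow> x = 0)"
    unfolding full_rank_injective by (rule vec.inj_iff_eq_0)
  also have "\<dots> \<longleftrightarrow> independent_columns (range (($) f))"
    unfolding independent_columns_def
  proof safe
    fix w :: "real^'n" assume L: "\<forall>x. col_submat A f *v x = 0 \<longrightarrow> x = 0"
      and w: "supp w \<subseteq> range (($) f)" "A *v w = 0"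
    have "(\<chi> k. w $ (f $ k)) = 0"
      using L w by (metis extend_zero_restrict[OF f] mult_extend_zero)
    moreover have "extend_zero f 0 = 0" by (simp add: extend_zero_def vec_eq_iff cong: if_cong)
    ultimately show "w = 0" using extend_zero_restrict[OF f w(1)] by simp
  next
    fix x assume R: "\<forall>w. supp w \<subseteq> range (($) f) \<and> A *v w = 0 \<longrightarrow> w = 0"
      and x: "col_submat A f *v x = 0"
    then have "extend_zero f x = 0" using supp_extend_zero by (metis mult_extend_zero)
    then show "x = 0" using extend_zero_nth[OF f, of x] by (simp add: vec_eq_iff)
  qed
  finally show ?thesis by simp
qed

lemma proj_residual_swap: "proj_residual q p t = proj_residual p q t"
  by (simp add: proj_residual_def inner_commute[of "col q" "col p"])

text \<open>Columns \<open>p\<close> and \<open>q\<close> are orthogonal to the residual, so only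
  \<open>t\<close> can witness dominance.\<close>

lemma dominant_on_proj_residual_iff:
  assumes "S = {p, q, t}" "S \<noteq> UNIV"
  shows "dominant_on S (proj_residual p q t) \<longleftrightarrow>
    (MAX i\<in>-S. max (col i \<bullet> proj_residual p q t) 0) < col t \<bullet> proj_residual p q t"
proof -
  have "- S \<noteq> {}" using assms(2) by blast
  then show ?thesis
    by (simp add: dominant_on_def) (auto simp: assms(1) inner_proj_residual(1,2))
qed

text \<open>Index \<open>j\<close> never witnesses dominance over the residual after \<open>j\<close>, since that residual is
  orthogonal to column \<open>j\<close>; and the coefficient of column \<open>j\<close> does not affect this residual.\<close>

lemma schur_condition_iff:
  fixes s :: "'n^3" and J :: "3^1" and I :: "3^2"
  assumes "inj (($) s)" "range (($) s) \<noteq> UNIV" and J: "J $ 1 \<notin> range (($) I)" "I $ 1 \<noteq> I $ 2"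
  defines "B \<equiv> col_submat A s" and "S \<equiv> range (($) s)"
  shows "(\<forall>z\<in>nonneg_orthant. supp z = S \<longrightarrow>
      dominant_on S (A *v z - (col (s $ (J $ 1)) \<bullet> (A *v z)) *\<^sub>R col (s $ (J $ 1)))) \<longleftrightarrow>
    (\<forall>v\<in>pos_orthant. infnorm_on (- S) (pos_part
        ((transpose A ** (mat 1 - col_submat B J ** transpose (col_submat B J)) ** col_submat B I) *v v))
      < infnorm (pos_part (schur_complement (transpose B ** B) J I *v v)))"
proof -
  define j where "j = J $ 1"
  define b where "b h = col (s $ h)" for h
  define R where "R w = w - (b j \<bullet> w) *\<^sub>R b j" for w
  have jI: "j \<noteq> I $ 1" "j \<noteq> I $ 2" using J(1) by (auto simp: j_def)
  have UNIV: "UNIV = {j, I $ 1, I $ 2}"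
  proof (rule sym, rule card_subset_eq)
    show "card {j, I $ 1, I $ 2} = card (UNIV :: 3 set)" using jI J(2) by simp
  qed simp_all
  have unit: "norm (column (J $ 1) B) = 1" by (simp add: B_def column_col_submat norm_column)
  have bj: "column (J $ 1) B = b j" by (simp add: B_def column_col_submat b_def j_def)
  have R_orth: "b j \<bullet> R w = 0" for w by (simp add: R_def b_def inner_diff_right inner_col_self)
  have dom_R: "dominant_on S (R w) \<longleftrightarrow> (\<forall>i\<in>-S. \<exists>h. max (col i \<bullet> R w) 0 < b (I $ h) \<bullet> R w)" for w
  proof -
    have *: "(\<exists>k\<in>S. c < col k \<bullet> R w) \<longleftrightarrow> (\<exists>h. c < b (I $ h) \<bullet> R w)" if "0 \<le> c" for c
    proof -
      have "(\<exists>k\<in>S. c < col k \<bullet> R w) \<longleftrightarrow> (\<exists>h\<in>UNIV. c < b h \<bullet> R w)"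
        by (simp add: S_def b_def)
      also have "\<dots> \<longleftrightarrow> (\<exists>h. c < b (I $ h) \<bullet> R w)"
        unfolding UNIV using that exhaust_2 by (auto simp: R_orth) metis
      finally show ?thesis .
    qed
    have "(\<exists>k\<in>S. max x 0 < col k \<bullet> R w) \<longleftrightarrow> (\<exists>h. max x 0 < b (I $ h) \<bullet> R w)" for x
      by (rule *) simp
    then show ?thesis unfolding dominant_on_def by (intro ball_cong refl)
  qed
  have schur: "schur_complement (transpose B ** B) J I *v v =
      transpose (col_submat B I) *v R (col_submat B I *v v)" for v
    unfolding schur_complement_gram_mult(2)[OF unit] bj R_def ..
  have outer: "(transpose A ** (mat 1 - col_submat B J ** transpose (col_submat B J)) ** col_submat B I) *v v =
      transpose A *v R (col_submat B I *v v)" for v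
    unfolding matrix_vector_mul_assoc[symmetric] schur_complement_gram_mult(1)[OF unit] bj R_def ..
  have col_I: "column h (col_submat B I) = b (I $ h)" for h
    by (simp add: column_col_submat B_def b_def)
  have B: "B *v u = u $ j *\<^sub>R b j + u $ (I $ 1) *\<^sub>R b (I $ 1) + u $ (I $ 2) *\<^sub>R b (I $ 2)" for u
    using jI J(2) unfolding matrix_mult_sum UNIV
    by (simp add: scalar_mult_eq_scaleR column_col_submat B_def b_def)
  have C: "col_submat B I *v v = v $ 1 *\<^sub>R b (I $ 1) + v $ 2 *\<^sub>R b (I $ 2)" for v
    by (simp add: matrix_mult_sum sum_2 scalar_mult_eq_scaleR col_I)
  have R_B: "R (B *v u) = R (col_submat B I *v (\<chi> h. u $ (I $ h)))" for u
    unfolding B C by (simp add: R_def inner_add_right b_def inner_col_self algebra_simps)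
  have surj: "(\<forall>u\<in>pos_orthant. P (\<chi> h. u $ (I $ h))) \<longleftrightarrow> (\<forall>v\<in>pos_orthant. P v)"
    for P :: "real^2 \<Rightarrow> bool"
  proof safe
    fix v :: "real^2" assume L: "\<forall>u\<in>pos_orthant. P (\<chi> h. u $ (I $ h))" and v: "v \<in> pos_orthant"
    \<comment> \<open>The entry at \<open>j\<close> is not seen by the restriction to
      \<open>I\<close>, so any positive value such as 1 serves.\<close>
    define u :: "real^3" where
      "u = (\<chi> k. if k = I $ 1 then v $ 1 else if k = I $ 2 then v $ 2 else 1)"
    have "u \<in> pos_orthant" using v by (simp add: u_def pos_orthant_def)
    moreover have "(\<chi> h. u $ (I $ h)) = v" using J(2) by (simp add: vec_eq_iff forall_2 u_def)
    ultimately show "P v" using L by force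
  qed (simp add: pos_orthant_def)
  have "(\<forall>z\<in>nonneg_orthant. supp z = S \<longrightarrow> dominant_on S (R (A *v z))) \<longleftrightarrow>
      (\<forall>u\<in>pos_orthant. dominant_on S (R (B *v u)))"
    unfolding S_def B_def by (rule ball_full_support_iff[OF assms(1)])
  also have "\<dots> \<longleftrightarrow> (\<forall>v\<in>pos_orthant. dominant_on S (R (col_submat B I *v v)))"
    unfolding R_B by (rule surj)
  finally show ?thesis
    unfolding schur outer infnorm_on_pos_part_less_iff[OF assms(2), folded S_def]
      transpose_mult_component col_I dom_R[symmetric]
    unfolding R_def b_def j_def .
qed

end

section \<open>Assembly of the four conditions\<close>

lemma all_orderings_iff:
  assumes "distinct [a, b, c]"
  shows "(\<forall>p q t. distinct [p, q, t] \<and> {a, b, c} = {p, q, t} \<and> Q p q t \<longrightarrow> R p q t) \<longleftrightarrow>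
    (Q a b c \<longrightarrow> R a b c) \<and> (Q b a c \<longrightarrow> R b a c) \<and> (Q a c b \<longrightarrow> R a c b) \<and>
    (Q c a b \<longrightarrow> R c a b) \<and> (Q b c a \<longrightarrow> R b c a) \<and> (Q c b a \<longrightarrow> R c b a)"
proof -
  have "distinct [p, q, t] \<and> {a, b, c} = {p, q, t} \<longleftrightarrow>
      (p, q, t) \<in> {(a, b, c), (b, a, c), (a, c, b), (c, a, b), (b, c, a), (c, b, a)}" for p q t
  proof
    assume *: "distinct [p, q, t] \<and> {a, b, c} = {p, q, t}"
    then have "p \<in> {a, b, c}" "q \<in> {a, b, c}" "t \<in> {a, b, c}" by simp_all
    with * show "(p, q, t) \<in> {(a, b, c), (b, a, c), (a, c, b), (c, a, b), (b, c, a), (c, b, a)}"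
      by (elim insertE emptyE) simp_all
  next
    assume "(p, q, t) \<in> {(a, b, c), (b, a, c), (a, c, b), (c, a, b), (b, c, a), (c, b, a)}"
    then show "distinct [p, q, t] \<and> {a, b, c} = {p, q, t}"
      using assms by (elim insertE emptyE) (auto simp: insert_commute)
  qed
  then have "(\<forall>p q t. distinct [p, q, t] \<and> {a, b, c} = {p, q, t} \<and> Q p q t \<longrightarrow> R p q t) \<longleftrightarrow>
      (\<forall>(p, q, t)\<in>{(a, b, c), (b, a, c), (a, c, b), (c, a, b), (b, c, a), (c, b, a)}.
        Q p q t \<longrightarrow> R p q t)"
    by (simp only: Ball_def split_paired_All prod.case conj_assoc[symmetric] imp_conjL)
  then show ?thesis by simp
qed

theorem theorem5p4:
  fixes A :: "real^'n^'m"
    and s :: "'n^3"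
    and S :: "'n set"
    and A\<^sub>S :: "real^3^'m"
    and M :: "real^3^3"
    and \<theta> :: "'n \<Rightarrow> 'n \<Rightarrow> real"
    and \<theta>12 \<theta>13 \<theta>23 \<Delta>12 \<Delta>13 \<Delta>23 :: real
  defines "S \<equiv> {s $ 1, s $ 2, s $ 3}"
    and "A\<^sub>S \<equiv> col_submat A s"
    and "M \<equiv> transpose A\<^sub>S ** A\<^sub>S"
    and "\<theta> \<equiv> \<lambda>i j. column i A \<bullet> column j A"
    and "\<theta>12 \<equiv> \<theta> (s $ 1) (s $ 2)"
    and "\<theta>13 \<equiv> \<theta> (s $ 1) (s $ 3)"
    and "\<theta>23 \<equiv> \<theta> (s $ 2) (s $ 3)"
    and "\<Delta>12 \<equiv> \<theta>12 - \<theta>13 * \<theta>23"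
    and "\<Delta>13 \<equiv> \<theta>13 - \<theta>12 * \<theta>23"
    and "\<Delta>23 \<equiv> \<theta>23 - \<theta>12 * \<theta>13"
  assumes unit_columns: "\<And>i. norm (column i A) = 1"
    and N_ge_4: "CARD('n) \<ge> 4"
    and s_distinct: "distinct [s $ 1, s $ 2, s $ 3]"
  shows "(\<forall>x \<in> nonneg_orthant. x \<noteq> 0 \<and> supp x = S \<longrightarrow> cmp_recovered A nonneg_orthant x)
    \<longleftrightarrow>
      rank A\<^sub>S = 3
    \<and> (\<forall>u \<in> pos_orthant.
         infnorm (pos_part ((transpose A\<^sub>S ** A\<^sub>S) *v u))
           > infnorm_on (- S) (pos_part ((transpose A ** A\<^sub>S) *v u)))
    \<and> (\<forall>(J :: 3^1, I :: 3^2) \<in>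
           {(vector [1], vector [2, 3]), (vector [2], vector [1, 3]), (vector [3], vector [1, 2])}.
         \<forall>v \<in> pos_orthant.
           infnorm (pos_part (schur_complement M J I *v v))
             > infnorm_on (- S) (pos_part
                 ((transpose A ** (mat 1 - col_submat A\<^sub>S J ** transpose (col_submat A\<^sub>S J))
                     ** col_submat A\<^sub>S I) *v v)))
    \<and> (1 - \<theta>12\<^sup>2 > min \<Delta>13 \<Delta>23 \<longrightarrow>
         det M > (MAX i \<in> - S. max (\<theta> i (s $ 3) * (1 - \<theta>12\<^sup>2)
                                     - \<theta> i (s $ 1) * \<Delta>13 - \<theta> i (s $ 2) * \<Delta>23) 0))
    \<and> (1 - \<theta>13\<^sup>2 > min \<Delta>12 \<Delta>23 \<longrightarrow>
         det M > (MAX i \<in> - S. max (\<theta> i (s $ 2) * (1 - \<theta>13\<^sup>2)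
                                     - \<theta> i (s $ 1) * \<Delta>12 - \<theta> i (s $ 3) * \<Delta>23) 0))
    \<and> (1 - \<theta>23\<^sup>2 > min \<Delta>12 \<Delta>13 \<longrightarrow>
         det M > (MAX i \<in> - S. max (\<theta> i (s $ 1) * (1 - \<theta>23\<^sup>2)
                                     - \<theta> i (s $ 2) * \<Delta>12 - \<theta> i (s $ 3) * \<Delta>13) 0))"
proof -
  interpret unit_column_matrix A by standard (rule unit_columns)
  define a b c where "a = s $ 1" and "b = s $ 2" and "c = s $ 3"
  note abc_def = a_def b_def c_def
  have dist: "distinct [a, b, c]" using s_distinct by (simp add: abc_def)
  have inj: "inj (($) s)" using s_distinct unfolding inj_def forall_3 by auto
  have S_range: "S = range (($) s)" unfolding S_def UNIV_3 by auto
  have S: "S = {a, b, c}" by (simp add: S_def abc_def)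
  have card: "card S = 3" using dist S by simp
  then have proper: "S \<noteq> UNIV" using N_ge_4 by auto
  have rec: "(\<forall>x\<in>nonneg_orthant. x \<noteq> 0 \<and> supp x = S \<longrightarrow> cmp_recovered A nonneg_orthant x) \<longleftrightarrow>
      (\<forall>x\<in>nonneg_orthant. supp x = S \<longrightarrow> cmp_recovered A nonneg_orthant x)"
    using S by (force simp: supp_def)
  have i: "independent_columns S \<longleftrightarrow> rank A\<^sub>S = 3"
    unfolding S_range A\<^sub>S_def independent_columns_iff_rank[OF inj] by simp
  have ii: "(\<forall>z\<in>nonneg_orthant. supp z = S \<longrightarrow> dominant_on S (A *v z)) \<longleftrightarrow>
      (\<forall>u\<in>pos_orthant. infnorm (pos_part ((transpose A\<^sub>S ** A\<^sub>S) *v u))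
        > infnorm_on (- S) (pos_part ((transpose A ** A\<^sub>S) *v u)))"
    unfolding infnorm_on_pos_part_less_iff[OF proper]
    unfolding matrix_vector_mul_assoc[symmetric] transpose_mult_component S_range
      ball_full_support_iff[OF inj] A\<^sub>S_def column_col_submat
    by (simp add: dominant_on_def)
  have iii: "(\<forall>z\<in>nonneg_orthant. supp z = S \<longrightarrow>
        dominant_on S (A *v z - (col (s $ (J $ 1)) \<bullet> (A *v z)) *\<^sub>R col (s $ (J $ 1)))) \<longleftrightarrow>
      (\<forall>v\<in>pos_orthant. infnorm (pos_part (schur_complement M J I *v v))
        > infnorm_on (- S) (pos_part
            ((transpose A ** (mat 1 - col_submat A\<^sub>S J ** transpose (col_submat A\<^sub>S J))
              ** col_submat A\<^sub>S I) *v v)))"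
    if "J $ 1 \<notin> {I $ 1, I $ 2}" "I $ 1 \<noteq> I $ 2" for J :: "3^1" and I :: "3^2"
    unfolding S_range M_def A\<^sub>S_def
    by (rule schur_condition_iff) (use that inj proper S_range in \<open>auto simp: UNIV_2\<close>)
  have M_nth: "M $ h $ k = col (s $ h) \<bullet> col (s $ k)" for h k
    by (simp add: M_def A\<^sub>S_def col_submat_def matrix_matrix_mult_def transpose_def inner_vec_def
        column_def)
  have comm: "col b \<bullet> col a = col a \<bullet> col b" "col c \<bullet> col a = col a \<bullet> col c"
    "col c \<bullet> col b = col b \<bullet> col c" by (simp_all add: inner_commute)
  \<comment> \<open>The Gram determinant is symmetric in the three columns, so \<open>det M\<close>
    serves for each choice of the last column.\<close>
  have det_M: "det M = col c \<bullet> proj_residual a b c" "det M = col b \<bullet> proj_residual a c b"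
    "det M = col a \<bullet> proj_residual b c a"
    by (simp_all add: det_3 M_nth inner_proj_residual inner_col_self comm power2_eq_square
        algebra_simps flip: abc_def)
  have \<theta>_abc: "\<theta>12 = col a \<bullet> col b" "\<theta>13 = col a \<bullet> col c" "\<theta>23 = col b \<bullet> col c"
    by (simp_all add: \<theta>12_def \<theta>13_def \<theta>23_def \<theta>_def abc_def)
  have inner_proj:
    "col i \<bullet> proj_residual a b c = \<theta> i c * (1 - \<theta>12\<^sup>2) - \<theta> i a * \<Delta>13 - \<theta> i b * \<Delta>23"
    "col i \<bullet> proj_residual a c b = \<theta> i b * (1 - \<theta>13\<^sup>2) - \<theta> i a * \<Delta>12 - \<theta> i c * \<Delta>23"
    "col i \<bullet> proj_residual b c a = \<theta> i a * (1 - \<theta>23\<^sup>2) - \<theta> i b * \<Delta>12 - \<theta> i c * \<Delta>13" for i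
    by (simp_all add: proj_residual_def inner_diff_right \<theta>_def \<Delta>12_def \<Delta>13_def \<Delta>23_def \<theta>_abc
        comm mult.commute)
  have dom: "dominant_on S (proj_residual a b c) \<longleftrightarrow> det M >
      (MAX i\<in>-S. max (\<theta> i c * (1 - \<theta>12\<^sup>2) - \<theta> i a * \<Delta>13 - \<theta> i b * \<Delta>23) 0)"
    "dominant_on S (proj_residual a c b) \<longleftrightarrow> det M >
      (MAX i\<in>-S. max (\<theta> i b * (1 - \<theta>13\<^sup>2) - \<theta> i a * \<Delta>12 - \<theta> i c * \<Delta>23) 0)"
    "dominant_on S (proj_residual b c a) \<longleftrightarrow> det M >
      (MAX i\<in>-S. max (\<theta> i a * (1 - \<theta>23\<^sup>2) - \<theta> i b * \<Delta>12 - \<theta> i c * \<Delta>13) 0)"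
    unfolding inner_proj[symmetric]
    using dominant_on_proj_residual_iff[OF _ proper, of a b c]
      dominant_on_proj_residual_iff[OF _ proper, of a c b]
      dominant_on_proj_residual_iff[OF _ proper, of b c a] det_M S
    by (auto simp: insert_commute)
  \<comment> \<open>The six orderings are grouped by their last index. The two orders of the first
    pair share a residual, and the disjunction of their premises is the comparison with the
    minimum.\<close>
  have iv: "(\<forall>p q t. distinct [p, q, t] \<and> S = {p, q, t} \<and>
        col q \<bullet> col t - (col p \<bullet> col q) * (col p \<bullet> col t) < 1 - (col p \<bullet> col q)\<^sup>2 \<longrightarrow>
        dominant_on S (proj_residual p q t)) \<longleftrightarrow>
      (1 - \<theta>12\<^sup>2 > min \<Delta>13 \<Delta>23 \<longrightarrow> dominant_on S (proj_residual a b c)) \<and>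
      (1 - \<theta>13\<^sup>2 > min \<Delta>12 \<Delta>23 \<longrightarrow> dominant_on S (proj_residual a c b)) \<and>
      (1 - \<theta>23\<^sup>2 > min \<Delta>12 \<Delta>13 \<longrightarrow> dominant_on S (proj_residual b c a))"
    unfolding S all_orderings_iff[OF dist] min_less_iff_disj
      proj_residual_swap[of b a] proj_residual_swap[of c a] proj_residual_swap[of c b]
    unfolding \<Delta>12_def \<Delta>13_def \<Delta>23_def \<theta>_abc comm
    by (auto simp: mult.commute)
  have iii_all: "(\<forall>j\<in>S. \<forall>z\<in>nonneg_orthant. supp z = S \<longrightarrow>
      dominant_on S (A *v z - (col j \<bullet> (A *v z)) *\<^sub>R col j)) \<longleftrightarrow>
    (\<forall>(J :: 3^1, I :: 3^2) \<in>
       {(vector [1], vector [2, 3]), (vector [2], vector [1, 3]), (vector [3], vector [1, 2])}.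
     \<forall>z\<in>nonneg_orthant. supp z = S \<longrightarrow>
        dominant_on S (A *v z - (col (s $ (J $ 1)) \<bullet> (A *v z)) *\<^sub>R col (s $ (J $ 1))))"
    unfolding S_def by simp
  show ?thesis
    unfolding rec recovery_iff[OF card proper] i ii iv dom iii_all
    using iii[of "vector [1]" "vector [2, 3]"] iii[of "vector [2]" "vector [1, 3]"]
      iii[of "vector [3]" "vector [1, 2]"]
    by (simp add: abc_def)
qed

end
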